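(* Let $d\in\mathbb N$, $p\ge 1$, and let $g:\mathbb R^d\to\mathbb R$ satisfy the growth condition with growth rate $M\in\mathbb R$. Let $q$ be a product density on $\mathbb R^d$ with component-wise inverse-CDF map $\mathcal T$ as in the context, let $\{\bm u_1,\dots,\bm u_N\}$ be RQMC point sets satisfying the RQMC assumption of the context, and let $I_N(g)=\frac1N\sum_{i=1}^N g(\mathcal T(\bm u_i))$ and $q(g)=\int_{\mathbb R^d}g(\bm x)q(\bm x)\,d\bm x$. (i) If $M<0$, then $$\Big\{\mathbb E_{\mathrm{RQMC}}\big|I_N(g)-q(g)\big|^p\Big\}^{1/p}=\mathcal O\big(N^{-1}(\log N)^{d-1}\big).$$ (ii) If $q\in\mathrm{SG}(\eta,\alpha)$ for some constants $\eta\in\mathbb Z$ and $\alpha>0$, and $0\le M<\alpha/p$, then for any $\epsilon>0$, $$\Big\{\mathbb E_{\mathrm{RQMC}}\big|I_N(g)-q(g)\big|^p\Big\}^{1/p}=\mathcal O\big(N^{-1+pM/\alpha+\epsilon}\big).$$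
   Context: Notation: $\|\cdot\|$ is the Euclidean norm; for $\bm a\in\mathbb N_0^d$, $|\bm a|=a_1+\dots+a_d$ and $D^{\bm a}$ is the corresponding partial derivative. Growth condition with growth rate $M\in\mathbb R$: $g\in C^d(\mathbb R^d)$ and there is a constant $C>0$ such that $|D^{\bm a}g(\bm x)|\le C\exp\{M\|\bm x\|^2\}$ for all $\bm x\in\mathbb R^d$ and all $\bm a\in\mathbb N_0^d$ with $|\bm a|\le d$. Density and transport: $q(\bm x)=\prod_{j=1}^d q_j(x_j)$, where each $q_j$ is a probability density on $\mathbb R$ that is strictly positive and continuous. $\mathcal T(\bm u)=(\mathcal T_1(u_1),\dots,\mathcal T_d(u_d))$ for $\bm u\in(0,1)^d$, where $\mathcal T_j:(0,1)\to\mathbb R$ is the inverse of the cumulative distribution function of $q_j$. Sub-Gaussian-type tail: for $\eta\in\mathbb Z$, $\alpha>0$, $q\in\mathrm{SG}(\eta,\alpha)$ means $\limsup_{t\to\infty}t^{-\eta}\exp(\alpha t^2)\,\mathbb P_q(\|\bm X\|>t)<\infty$, where $\bm X\sim q$. RQMC assumption: for each sample size $N$ (ranging over an infinite set of admissible integers $N\ge2$), $\bm u_1,\dots,\bm u_N$ are random points in $(0,1)^d$ (not necessarily independent) such that (1) each $\bm u_i$ is marginally uniformly distributed on $(0,1)^d$; (2) there is a constant $B_d>0$ independent of $N$ such that, with probability one, $D_N^*(\bm u_1,\dots,\bm u_N)\le B_d\frac{(\log N)^{d-1}}{N}$, where $D_N^*(\bm u_1,\dots,\bm u_N)=\sup_{\bm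 z\in(0,1)^d}\big|\frac1N\sum_{i=1}^N\mathbf 1\{\bm u_i\in[\bm 0,\bm z)\}-\prod_{j=1}^d z_j\big|$ is the star discrepancy. $\mathbb E_{\mathrm{RQMC}}$ is expectation over the randomness of the points. $\mathcal O(\cdot)$ is meant as $N\to\infty$ along admissible $N$, with implicit constant independent of $N$ (it may depend on everything else, e.g. $d,p,g,q,\epsilon$). *)

theory Defs
  imports "HOL-Probability.Probability" "HOL-Library.Landau_Symbols"
begin

text \<open>
  Functions on \<open>\<real>\<^sup>d\<close> have type \<open>real ^ 'n \<Rightarrow> real\<close> with \<open>d = CARD('n)\<close>, and multi-indices have
  type \<open>'n \<Rightarrow> nat\<close>.
\<close>

definition partial_deriv :: "'n::finite \<Rightarrow> (real ^ 'n \<Rightarrow> real) \<Rightarrow> real ^ 'n \<Rightarrow> real" where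
  "partial_deriv i f x = deriv (\<lambda>t. f (x + t *\<^sub>R axis i 1)) 0"

fun C_diff :: "nat \<Rightarrow> (real ^ 'n::finite \<Rightarrow> real) \<Rightarrow> bool" where
  "C_diff 0 f \<longleftrightarrow> continuous_on UNIV f"
| "C_diff (Suc k) f \<longleftrightarrow> continuous_on UNIV f \<and>
     (\<forall>i. (\<forall>x. (\<lambda>t. f (x + t *\<^sub>R axis i 1)) differentiable (at 0)) \<and> C_diff k (partial_deriv i f))"

text \<open>
  The type \<open>'n\<close> carries no order, so one enumeration of the coordinates is fixed. Iterated partial
  derivatives of order at most \<open>k\<close> of a \<open>C\<^sup>k\<close> function do not depend on the order of
  differentiation, hence not on this choice.
\<close>

definition coord_enum :: "'n::finite list" where
  "coord_enum = (SOME is. distinct is \<and> set is = UNIV)"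

lemma coord_enum: "distinct (coord_enum :: 'n::finite list)" "set (coord_enum :: 'n list) = UNIV"
proof -
  have "\<exists>is :: 'n list. distinct is \<and> set is = UNIV"
    using finite_distinct_list[of "UNIV :: 'n set"] by auto
  from someI_ex[OF this]
  show "distinct (coord_enum :: 'n list)" "set (coord_enum :: 'n list) = UNIV"
    unfolding coord_enum_def by blast+
qed

definition multi_deriv :: "('n::finite \<Rightarrow> nat) \<Rightarrow> (real ^ 'n \<Rightarrow> real) \<Rightarrow> real ^ 'n \<Rightarrow> real" where
  "multi_deriv a f = foldr (\<lambda>i. partial_deriv i ^^ a i) coord_enum f"

definition growth_condition :: "real \<Rightarrow> (real ^ 'n::finite \<Rightarrow> real) \<Rightarrow> bool" where
  "growth_condition M g \<longleftrightarrow> C_diff CARD('n) g \<and>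
     (\<exists>C>0. \<forall>a :: 'n \<Rightarrow> nat. (\<Sum>i\<in>UNIV. a i) \<le> CARD('n) \<longrightarrow>
        (\<forall>x. \<bar>multi_deriv a g x\<bar> \<le> C * exp (M * (norm x)\<^sup>2)))"

definition positive_continuous_density :: "(real \<Rightarrow> real) \<Rightarrow> bool" where
  "positive_continuous_density f \<longleftrightarrow> (\<forall>x. 0 < f x) \<and> continuous_on UNIV f \<and>
     prob_space (density lborel (\<lambda>x. ennreal (f x)))"

definition product_density :: "('n::finite \<Rightarrow> real \<Rightarrow> real) \<Rightarrow> real ^ 'n \<Rightarrow> real" where
  "product_density q x = (\<Prod>j\<in>UNIV. q j (x $ j))"

text \<open>
  The cumulative distribution function of a strictly positive density is a bijection from \<open>\<real>\<close> onto
  \<open>(0,1)\<close>; the map below is only meaningful on \<open>(0,1)\<^sup>d\<close>.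
\<close>

definition inverse_cdf_map :: "('n::finite \<Rightarrow> real \<Rightarrow> real) \<Rightarrow> real ^ 'n \<Rightarrow> real ^ 'n" where
  "inverse_cdf_map q u = (\<chi> j. inv (cdf (density lborel (\<lambda>x. ennreal (q j x)))) (u $ j))"

definition SG :: "int \<Rightarrow> real \<Rightarrow> (real ^ 'n::finite \<Rightarrow> real) \<Rightarrow> bool" where
  "SG \<eta> \<alpha> f \<longleftrightarrow>
     Limsup at_top (\<lambda>t::real. ereal (t powi (- \<eta>) * exp (\<alpha> * t\<^sup>2) *
        measure (density lborel (\<lambda>x. ennreal (f x))) {x. norm x > t})) < \<infinity>"

text \<open>In \<open>real ^ 'n\<close>, \<open>1\<close> is the all-ones vector, so \<open>box 0 1\<close> is the open cube \<open>(0,1)\<^sup>d\<close>.\<close>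

definition star_discrepancy :: "nat \<Rightarrow> (nat \<Rightarrow> real ^ 'n::finite) \<Rightarrow> real" where
  "star_discrepancy N y =
     (SUP z\<in>box 0 1. \<bar>(1 / real N) * (\<Sum>i=1..N. indicator {v. \<forall>j. 0 \<le> v $ j \<and> v $ j < z $ j} (y i))
        - (\<Prod>j\<in>UNIV. z $ j)\<bar>)"

text \<open>
  \<open>A\<close> is the set of admissible sample sizes; \<open>P N\<close> is the probability space on which the \<open>N\<close> points
  \<open>u N 1, \<dots>, u N N\<close> live.
\<close>

definition rqmc_points ::
  "nat set \<Rightarrow> (nat \<Rightarrow> 'w measure) \<Rightarrow> (nat \<Rightarrow> nat \<Rightarrow> 'w \<Rightarrow> real ^ 'n::finite) \<Rightarrow> bool" where
  "rqmc_points A P u \<longleftrightarrow>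
     infinite A \<and> (\<forall>N\<in>A. 2 \<le> N \<and> prob_space (P N)) \<and>
     (\<forall>N\<in>A. \<forall>i\<in>{1..N}. u N i \<in> borel_measurable (P N) \<and>
        (\<forall>\<omega>\<in>space (P N). u N i \<omega> \<in> box 0 1) \<and>
        distr (P N) borel (u N i) = uniform_measure lborel (box 0 1)) \<and>
     (\<exists>B>0. \<forall>N\<in>A. AE \<omega> in P N.
        star_discrepancy N (\<lambda>i. u N i \<omega>) \<le> B * (ln (real N) ^ (CARD('n) - 1) / real N))"

definition rqmc_estimate ::
  "(real ^ 'n::finite \<Rightarrow> real) \<Rightarrow> (real ^ 'n \<Rightarrow> real ^ 'n) \<Rightarrow> nat \<Rightarrow> (nat \<Rightarrow> real ^ 'n) \<Rightarrow> real" where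
  "rqmc_estimate g T N y = (1 / real N) * (\<Sum>i=1..N. g (T (y i)))"

definition target_integral :: "(real ^ 'n::finite \<Rightarrow> real) \<Rightarrow> (real ^ 'n \<Rightarrow> real) \<Rightarrow> real" where
  "target_integral g f = (\<integral>x. g x * f x \<partial>lborel)"

definition abs_error_pow ::
  "real \<Rightarrow> (real ^ 'n::finite \<Rightarrow> real) \<Rightarrow> ('n \<Rightarrow> real \<Rightarrow> real) \<Rightarrow>
   (nat \<Rightarrow> nat \<Rightarrow> 'w \<Rightarrow> real ^ 'n) \<Rightarrow> nat \<Rightarrow> 'w \<Rightarrow> real" where
  "abs_error_pow p g q u N \<omega> =
     \<bar>rqmc_estimate g (inverse_cdf_map q) N (\<lambda>i. u N i \<omega>) -
      target_integral g (product_density q)\<bar> powr p"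

definition Lp_error ::
  "real \<Rightarrow> (real ^ 'n::finite \<Rightarrow> real) \<Rightarrow> ('n \<Rightarrow> real \<Rightarrow> real) \<Rightarrow> (nat \<Rightarrow> 'w measure) \<Rightarrow>
   (nat \<Rightarrow> nat \<Rightarrow> 'w \<Rightarrow> real ^ 'n) \<Rightarrow> nat \<Rightarrow> real" where
  "Lp_error p g q P u N = (\<integral>\<omega>. abs_error_pow p g q u N \<omega> \<partial>P N) powr (1 / p)"

text \<open>
  The Bochner integral of a non-integrable function is \<open>0\<close>, so a bound on \<^const>\<open>Lp_error\<close> is
  meaningful only together with integrability of both integrands.
\<close>

definition error_well_defined ::
  "real \<Rightarrow> (real ^ 'n::finite \<Rightarrow> real) \<Rightarrow> ('n \<Rightarrow> real \<Rightarrow> real) \<Rightarrow> nat set \<Rightarrow> (nat \<Rightarrow> 'w measure) \<Rightarrow>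
   (nat \<Rightarrow> nat \<Rightarrow> 'w \<Rightarrow> real ^ 'n) \<Rightarrow> bool" where
  "error_well_defined p g q A P u \<longleftrightarrow>
     integrable lborel (\<lambda>x. g x * product_density q x) \<and>
     (\<forall>N\<in>A. integrable (P N) (abs_error_pow p g q u N))"

end

(*
  Expanding g around 0 one coordinate at a time writes g(x) as a sum over coordinate sets S of the
  integrals over R^S of D^S g(y,0) K_S(x,y), where K_S(x,y) is, up to sign, the indicator of "x is in the
  orthant-shaped tail cut off by y". Hence the error I_N(g) - q(g) is the sum of the integrals of
  D^S g(y,0) Disc_S(y), with Disc_S(y) the difference of the empirical and the true mean of K_S(.,y).
  Multiplying out K_S into indicators of lower orthants, which T pulls back to boxes anchored at 0,
  bounds |Disc_S| by 2^d D, where D is the star discrepancy. On the other hand, for b >= 0,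
  |K_S(x,y)| <= exp(b |x|^2 - b |y|^2) bounds |Disc_S(y)| by exp(-b |y|^2) W, where W is the sum of the empirical and the true mean of exp(b |x|^2).
  Interpolating, |Disc_S(y)| <= (2^d D)^(1-t) (exp(-b |y|^2) W)^t, and if M < t b the growth condition
  makes the y-integral finite, so that |error| <= K D^(1-t) W^t. If t p <= 1 then the p-th
  moment of W^t is at most E W, which does not depend on N.
  Part (i) is t = b = 0. In part (ii) take b < alpha and t > M/alpha close to these bounds; the
  tail condition makes E exp(b |X|^2) finite.
*)

theory Submission
  imports Defs "HOL-Real_Asymp.Real_Asymp"
begin

section \<open>The law of the transported points\<close>

lemma positive_continuous_density_measurable:
  "positive_continuous_density f \<Longrightarrow> f \<in> borel_measurable borel"
  unfolding positive_continuous_density_def by (intro borel_measurable_continuous_onI) auto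

lemma real_distribution_density:
  assumes "positive_continuous_density f"
  shows "real_distribution (density lborel (\<lambda>x. ennreal (f x)))"
proof -
  interpret prob_space "density lborel (\<lambda>x. ennreal (f x))"
    using assms by (simp add: positive_continuous_density_def)
  show ?thesis by standard simp_all
qed

text \<open>Since \<open>f\<close> vanishes nowhere, an interval that is null for the density is
  null for Lebesgue measure, which a nondegenerate interval is not.\<close>

lemma strict_mono_cdf_density:
  assumes "positive_continuous_density f"
  shows "strict_mono (cdf (density lborel (\<lambda>x. ennreal (f x))))"
proof (rule strict_monoI)
  fix a b :: real assume ab: "a < b"
  let ?M = "density lborel (\<lambda>x. ennreal (f x))"
  interpret real_distribution ?M by (rule real_distribution_density[OF assms])
  note [measurable] = positive_continuous_density_measurable[OF assms]
  have pos: "0 < f x" for x using assms by (simp add: positive_continuous_density_def)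
  have "measure ?M {a<..b} \<noteq> 0"
  proof
    assume "measure ?M {a<..b} = 0"
    then have "emeasure ?M {a<..b} = 0" by (simp add: emeasure_eq_measure)
    then have "{a<..b} \<in> null_sets ?M" by auto
    then have "AE x in lborel. x \<in> {a<..b} \<longrightarrow> ennreal (f x) = 0"
      by (subst (asm) null_sets_density_iff) auto
    then have "AE x in lborel. x \<notin> {a<..b}"
      by (rule eventually_mono) (use pos in \<open>fastforce simp: ennreal_eq_0_iff not_le[symmetric]\<close>)
    then have "emeasure lborel {a<..b} = 0"
      by (subst (asm) AE_iff_measurable[where N="{a<..b}"]) auto
    with ab show False by simp
  qed
  moreover have "cdf ?M b - cdf ?M a = measure ?M {a<..b}" by (rule cdf_diff_eq[OF ab])
  ultimately show "cdf ?M a < cdf ?M b" by (smt (verit) measure_nonneg)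
qed

text \<open>Strict monotonicity pushes each value strictly between its neighbours, which lie in
  [0,1]. Values of the distribution functions are thus coordinates of points of the open cube over
  which the star discrepancy takes its supremum.\<close>

lemma cdf_density_bounds:
  assumes "positive_continuous_density f"
  shows "0 < cdf (density lborel (\<lambda>x. ennreal (f x))) x"
    and "cdf (density lborel (\<lambda>x. ennreal (f x))) x < 1"
proof -
  let ?F = "cdf (density lborel (\<lambda>x. ennreal (f x)))"
  interpret real_distribution "density lborel (\<lambda>x. ennreal (f x))"
    by (rule real_distribution_density[OF assms])
  have "?F (x - 1) < ?F x" "?F x < ?F (x + 1)"
    using strict_mono_cdf_density[OF assms] by (simp_all add: strict_mono_def)
  then show "0 < ?F x" "?F x < 1"
    using cdf_nonneg[of "x - 1"] cdf_bounded_prob[of "x + 1"] by linarith+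
qed

lemma measure_density_singleton:
  assumes "positive_continuous_density f"
  shows "measure (density lborel (\<lambda>x. ennreal (f x))) {x} = 0"
proof -
  note [measurable] = positive_continuous_density_measurable[OF assms]
  have "AE t in lborel. t \<in> {x} \<longrightarrow> ennreal (f t) = 0"
    by (rule AE_I[where N="{x}"]) auto
  then have "{x} \<in> null_sets (density lborel (\<lambda>x. ennreal (f x)))"
    by (subst null_sets_density_iff) (simp_all del: singleton_iff)
  then show ?thesis by (simp add: measure_eq_0_null_sets)
qed

lemma measure_density_lessThan:
  assumes "positive_continuous_density f"
  shows "measure (density lborel (\<lambda>x. ennreal (f x))) {..<x} = cdf (density lborel (\<lambda>x. ennreal (f x))) x"
proof -
  interpret real_distribution "density lborel (\<lambda>x. ennreal (f x))"
    by (rule real_distribution_density[OF assms])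
  have "{..<x} \<union> {x} = {..x}" by auto
  then show ?thesis
    using measure_density_singleton[OF assms, of x] finite_measure_Union[of "{..<x}" "{x}"]
    by (simp add: cdf_def2)
qed

text \<open>Absence of atoms makes the distribution function continuous, and its limits bracket
  \<open>v\<close>. Surjectivity gives the choice inside \<open>inv\<close> a genuine preimage, so
  that \<open>inverse_cdf_map\<close> is a right inverse on the open cube.\<close>

lemma cdf_density_surj:
  assumes f: "positive_continuous_density f" and v: "0 < v" "v < 1"
  shows "\<exists>x. cdf (density lborel (\<lambda>x. ennreal (f x))) x = v"
proof -
  let ?M = "density lborel (\<lambda>x. ennreal (f x))"
  let ?F = "cdf ?M"
  interpret real_distribution ?M by (rule real_distribution_density[OF f])
  note [measurable] = positive_continuous_density_measurable[OF f]
  have "eventually (\<lambda>x. ?F x < v) at_bot" using cdf_lim_at_bot v by (auto dest: order_tendstoD)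
  then obtain a where a: "?F a < v" by (meson eventually_happens trivial_limit_at_bot_linorder)
  have "eventually (\<lambda>x. v < ?F x) at_top" using cdf_lim_at_top_prob v by (auto dest: order_tendstoD)
  then obtain b where b: "v < ?F b" by (meson eventually_happens trivial_limit_at_top_linorder)
  have ab: "a \<le> b" using a b cdf_nondecreasing[of b a] by linarith
  have "isCont ?F x" for x using measure_density_singleton[OF f] by (simp add: isCont_cdf)
  then show ?thesis using IVT[of ?F a v b] a b ab by auto
qed

section \<open>Product sets and product integrals in \<open>real ^ 'n\<close>\<close>

lemma borel_measurable_vec_nth[measurable]:
  "(\<lambda>x :: real ^ 'n::finite. x $ i) \<in> borel_measurable borel"
  by (intro borel_measurable_continuous_onI continuous_intros)

lemma borel_measurable_vec_iff:
  fixes f :: "'a \<Rightarrow> real ^ 'n::finite"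
  shows "f \<in> borel_measurable M \<longleftrightarrow> (\<forall>j. (\<lambda>w. f w $ j) \<in> borel_measurable M)"
proof
  assume "f \<in> borel_measurable M"
  then show "\<forall>j. (\<lambda>w. f w $ j) \<in> borel_measurable M"
    by (intro allI measurable_compose[OF _ borel_measurable_vec_nth])
next
  assume *: "\<forall>j. (\<lambda>w. f w $ j) \<in> borel_measurable M"
  show "f \<in> borel_measurable M"
    by (subst borel_measurable_euclidean_space)
      (use * in \<open>auto simp: Basis_vec_def cart_eq_inner_axis[symmetric]\<close>)
qed

lemma prod_indicator_vec:
  "(\<Prod>i\<in>UNIV. indicator (D i) (x $ i)) = (indicator {x. \<forall>i. x $ i \<in> D i} x :: ennreal)"
  for x :: "'b ^ 'n::finite"
proof (cases "\<forall>i. x $ i \<in> D i")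
  case False
  then obtain i where "x $ i \<notin> D i" by blast
  then have "indicator (D i) (x $ i) = (0 :: ennreal)" by simp
  then have "(\<Prod>i\<in>UNIV. indicator (D i) (x $ i) :: ennreal) = 0"
    by (metis UNIV_I finite prod_zero)
  with False show ?thesis by simp
qed simp

lemma nn_integral_lborel_vec_prod:
  fixes f :: "'n::finite \<Rightarrow> real \<Rightarrow> ennreal"
  assumes "\<And>i. f i \<in> borel_measurable borel"
  shows "(\<integral>\<^sup>+x. (\<Prod>i\<in>UNIV. f i (x $ i)) \<partial>lborel) = (\<Prod>i\<in>UNIV. (\<integral>\<^sup>+x. f i x \<partial>lborel))"
proof -
  \<comment> \<open>Euclidean product integrals are indexed by basis vectors; \<open>k\<close>
    recovers the coordinate from its basis vector.\<close>
  define k :: "real ^ 'n \<Rightarrow> 'n" where "k b = (THE i. b = axis i 1)" for b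
  have k: "k (axis i 1) = i" for i by (simp add: k_def axis_eq_axis)
  have B: "(Basis :: (real ^ 'n) set) = range (\<lambda>i. axis i 1)" by (auto simp: Basis_vec_def)
  have inj: "inj (\<lambda>i. axis i 1 :: real ^ 'n)" by (auto simp: inj_on_def axis_eq_axis)
  have "(\<integral>\<^sup>+x. (\<Prod>b\<in>(Basis :: (real ^ 'n) set). f (k b) (x \<bullet> b)) \<partial>lborel)
      = (\<Prod>b\<in>(Basis :: (real ^ 'n) set). (\<integral>\<^sup>+x. f (k b) x \<partial>lborel))"
    by (rule nn_integral_lborel_prod) (use assms in auto)
  then show ?thesis
    by (simp add: B prod.reindex[OF inj] k o_def cart_eq_inner_axis)
qed

lemma emeasure_lborel_vec_prod:
  fixes D :: "'n::finite \<Rightarrow> real set"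
  assumes "\<And>i. D i \<in> sets borel"
  shows "emeasure lborel {x. \<forall>i. x $ i \<in> D i} = (\<Prod>i\<in>UNIV. emeasure lborel (D i))"
proof -
  note assms[measurable]
  have m: "{x :: real ^ 'n. \<forall>i. x $ i \<in> D i} \<in> sets borel" by measurable
  have "emeasure lborel {x. \<forall>i. x $ i \<in> D i} = (\<integral>\<^sup>+x. (\<Prod>i\<in>UNIV. indicator (D i) (x $ i)) \<partial>lborel)"
    using m by (simp add: prod_indicator_vec)
  also have "\<dots> = (\<Prod>i\<in>UNIV. \<integral>\<^sup>+x. indicator (D i) x \<partial>lborel)"
    by (rule nn_integral_lborel_vec_prod) auto
  finally show ?thesis by simp
qed

lemma emeasure_uniform_box:
  fixes v :: "real ^ 'n::finite"
  assumes "\<And>i. 0 \<le> v $ i" "\<And>i. v $ i \<le> 1"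
  shows "emeasure (uniform_measure lborel (box 0 1)) {x. \<forall>i. x $ i \<le> v $ i} = (\<Prod>i\<in>UNIV. v $ i)"
proof -
  have b: "box 0 1 = {x :: real ^ 'n. \<forall>i. x $ i \<in> {0<..<1}}" by (auto simp: mem_box_cart)
  have m: "{x :: real ^ 'n. \<forall>i. x $ i \<le> v $ i} \<in> sets lborel" by simp measurable
  have 1: "emeasure lborel (box 0 1 :: (real ^ 'n) set) = 1"
    unfolding b by (subst emeasure_lborel_vec_prod) auto
  have e: "emeasure lborel {x \<in> {0<..<1}. x \<le> v $ i} = ennreal (v $ i)" for i
  proof -
    have "emeasure lborel {x \<in> {0<..<1}. x \<le> v $ i} = emeasure lborel {0<..v $ i}"
    \<comment> \<open>A side of length 1 ends at the open face of the cube, so the slice loses its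
      right endpoint; its length is unaffected.\<close>
    proof (cases "v $ i = 1")
      case True
      then have "{x \<in> {0<..<1}. x \<le> v $ i} = {0<..<1}" by auto
      then show ?thesis using True by simp
    next
      case False
      then have "{x \<in> {0<..<1}. x \<le> v $ i} = {0<..v $ i}" using assms(2)[of i] by auto
      then show ?thesis by simp
    qed
    then show ?thesis using assms(1)[of i] by simp
  qed
  have "box 0 1 \<inter> {x. \<forall>i. x $ i \<le> v $ i} = {x. \<forall>i. x $ i \<in> {x \<in> {0<..<1}. x \<le> v $ i}}"
    by (auto simp: mem_box_cart)
  then have "emeasure lborel (box 0 1 \<inter> {x. \<forall>i. x $ i \<le> v $ i})
      = emeasure lborel {x. \<forall>i. x $ i \<in> {x \<in> {0<..<1}. x \<le> v $ i}}"
    by (rule arg_cong)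
  also have "\<dots> = (\<Prod>i\<in>UNIV. emeasure lborel {x \<in> {0<..<1}. x \<le> v $ i})"
    by (rule emeasure_lborel_vec_prod) measurable
  also have "\<dots> = ennreal (\<Prod>i\<in>UNIV. v $ i)"
    unfolding e by (rule prod_ennreal) (rule assms(1))
  finally have "emeasure (uniform_measure lborel (box 0 1)) {x. \<forall>i. x $ i \<le> v $ i}
      = ennreal (\<Prod>i\<in>UNIV. v $ i) / ennreal 1"
    using m 1 by (subst emeasure_uniform_measure) simp_all
  also have "\<dots> = ennreal (\<Prod>i\<in>UNIV. v $ i)"
    using assms(1) by (subst divide_ennreal) (simp_all add: prod_nonneg)
  finally show ?thesis .
qed

section \<open>Transport of the uniform law to the product density\<close>

locale positive_product_density =
  fixes q :: "'n::finite \<Rightarrow> real \<Rightarrow> real"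
  assumes q: "\<And>j. positive_continuous_density (q j)"
begin

abbreviation marginal_cdf :: "'n \<Rightarrow> real \<Rightarrow> real" where
  "marginal_cdf j \<equiv> cdf (density lborel (\<lambda>x. ennreal (q j x)))"

lemma marginal_cdf_inverse:
  assumes "w \<in> box 0 1"
  shows "marginal_cdf j (inverse_cdf_map q w $ j) = w $ j"
proof -
  have "0 < w $ j" "w $ j < 1" using assms by (auto simp: mem_box_cart)
  from someI_ex[OF cdf_density_surj[OF q this]]
  show ?thesis by (simp add: inverse_cdf_map_def inv_into_def)
qed

text \<open>The transport is increasing in each coordinate, so it pulls lower orthants back to
  anchored boxes. The strict form matches the half-open boxes of the star discrepancy, the weak form
  below the sets \<open>{..a}\<close> that determine the law.\<close>

lemma inverse_cdf_map_less_iff: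
  assumes "w \<in> box 0 1"
  shows "inverse_cdf_map q w $ j < y \<longleftrightarrow> w $ j < marginal_cdf j y"
  using strict_mono_less[OF strict_mono_cdf_density[OF q[of j]], of "inverse_cdf_map q w $ j" y]
  by (simp add: marginal_cdf_inverse[OF assms])

lemma inverse_cdf_map_le_iff:
  assumes "w \<in> box 0 1"
  shows "inverse_cdf_map q w $ j \<le> y \<longleftrightarrow> w $ j \<le> marginal_cdf j y"
  using strict_mono_less_eq[OF strict_mono_cdf_density[OF q[of j]], of "inverse_cdf_map q w $ j" y]
  by (simp add: marginal_cdf_inverse[OF assms])

lemma measurable_inverse_cdf_map:
  fixes X :: "'w \<Rightarrow> real ^ 'n"
  assumes X[measurable]: "X \<in> borel_measurable M" and box: "\<And>w. w \<in> space M \<Longrightarrow> X w \<in> box 0 1"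
  shows "(\<lambda>w. inverse_cdf_map q (X w)) \<in> borel_measurable M"
  unfolding borel_measurable_vec_iff borel_measurable_iff_le
proof (intro allI)
  fix j a
  have [measurable]: "(\<lambda>w. X w $ j) \<in> borel_measurable M" using X by (simp add: borel_measurable_vec_iff)
  have "{w \<in> space M. inverse_cdf_map q (X w) $ j \<le> a}
      = {w \<in> space M. X w $ j \<le> marginal_cdf j a}"
    using inverse_cdf_map_le_iff[OF box] by auto
  also have "\<dots> \<in> sets M" by measurable
  finally show "{w \<in> space M. inverse_cdf_map q (X w) $ j \<le> a} \<in> sets M" .
qed

lemma borel_measurable_product_density:
  "product_density q \<in> borel_measurable borel"
  unfolding product_density_def[abs_def]
  by (rule borel_measurable_prod)
    (rule measurable_compose[OF borel_measurable_vec_nth positive_continuous_density_measurable[OF q]])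

abbreviation target_measure :: "(real ^ 'n) measure" where
  "target_measure \<equiv> density lborel (\<lambda>x. ennreal (product_density q x))"

lemma emeasure_target_prod:
  fixes D :: "'n \<Rightarrow> real set"
  assumes D: "\<And>i. D i \<in> sets borel"
  shows "emeasure target_measure {x. \<forall>i. x $ i \<in> D i}
    = (\<Prod>i\<in>UNIV. emeasure (density lborel (\<lambda>x. ennreal (q i x))) (D i))"
proof -
  note D[measurable] q[THEN positive_continuous_density_measurable, measurable]
    borel_measurable_product_density[measurable]
  have m: "{x :: real ^ 'n. \<forall>i. x $ i \<in> D i} \<in> sets borel" by measurable
  have pos: "0 \<le> q j x" for j x
    using q[of j] by (simp add: positive_continuous_density_def less_imp_le)
  have pt: "ennreal (product_density q x) * indicator {x. \<forall>i. x $ i \<in> D i} x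
    = (\<Prod>i\<in>UNIV. ennreal (q i (x $ i)) * indicator (D i) (x $ i))" for x
    by (simp add: product_density_def prod.distrib prod_indicator_vec prod_ennreal pos)
  have "emeasure target_measure {x. \<forall>i. x $ i \<in> D i}
    = (\<integral>\<^sup>+x. (\<Prod>i\<in>UNIV. ennreal (q i (x $ i)) * indicator (D i) (x $ i)) \<partial>lborel)"
    using m by (simp add: emeasure_density pt)
  also have "\<dots> = (\<Prod>i\<in>UNIV. \<integral>\<^sup>+x. ennreal (q i x) * indicator (D i) x \<partial>lborel)"
    by (rule nn_integral_lborel_vec_prod) auto
  finally show ?thesis by (simp add: emeasure_density)
qed

lemma prob_space_target: "prob_space target_measure"
proof
  have "emeasure target_measure UNIV = (\<Prod>i\<in>UNIV. emeasure (density lborel (\<lambda>x. ennreal (q i x))) UNIV)"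
    using emeasure_target_prod[of "\<lambda>_. UNIV"] by simp
  also have "\<dots> = 1"
    using q prob_space.emeasure_space_1
    by (fastforce simp: positive_continuous_density_def intro: prod.neutral)
  finally show "emeasure target_measure (space target_measure) = 1" by simp
qed

lemma emeasure_target_atMost:
  "emeasure target_measure {..a} = ennreal (\<Prod>i\<in>UNIV. marginal_cdf i (a $ i))"
proof -
  have "emeasure (density lborel (\<lambda>x. ennreal (q i x))) {..a $ i} = ennreal (marginal_cdf i (a $ i))" for i
  proof -
    interpret real_distribution "density lborel (\<lambda>x. ennreal (q i x))"
      by (rule real_distribution_density[OF q])
    show ?thesis by (simp add: emeasure_eq_measure cdf_def)
  qed
  moreover have "{..a} = {x. \<forall>i. x $ i \<in> {..a $ i}}" by (auto simp: less_eq_vec_def)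
  ultimately have "emeasure target_measure {..a} = (\<Prod>i\<in>UNIV. ennreal (marginal_cdf i (a $ i)))"
    using emeasure_target_prod[of "\<lambda>i. {..a $ i}"] by simp
  also have "\<dots> = ennreal (\<Prod>i\<in>UNIV. marginal_cdf i (a $ i))"
    by (rule prod_ennreal) (rule less_imp_le[OF cdf_density_bounds(1)[OF q]])
  finally show ?thesis .
qed

lemma Int_stable_range_atMost_vec: "Int_stable (range (\<lambda>a. {..a :: real ^ 'm::finite}))"
proof (clarsimp simp: Int_stable_def)
  fix a b :: "real ^ 'm"
  have "{..a} \<inter> {..b} = {..\<chi> i. min (a $ i) (b $ i)}" by (auto simp: less_eq_vec_def)
  then show "{..a} \<inter> {..b} \<in> range atMost" by simp
qed

lemma UN_atMost_vec: "(\<Union>n. {..real n *\<^sub>R (1 :: real ^ 'm::finite)}) = UNIV"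
proof -
  have "\<exists>n. x \<le> real n *\<^sub>R (1 :: real ^ 'm)" for x
  proof -
    obtain n where n: "norm x \<le> real n" using real_arch_simple by blast
    have "x $ i \<le> real n" for i
      using component_le_norm_cart[of x i] n by linarith
    then show ?thesis by (intro exI[of _ n]) (simp add: less_eq_vec_def)
  qed
  then show ?thesis by blast
qed

text \<open>The orthants \<open>{..a}\<close> are a generator closed under intersection. Each pulls
  back to the orthant whose corner has the coordinates \<open>marginal_cdf j (a $ j)\<close>; its
  uniform mass is the product of these values, and so is the target mass of
  \<open>{..a}\<close>.\<close>

lemma distr_inverse_cdf_map:
  fixes X :: "'w \<Rightarrow> real ^ 'n"
  assumes P: "prob_space P"
    and X[measurable]: "X \<in> borel_measurable P" and box: "\<And>w. w \<in> space P \<Longrightarrow> X w \<in> box 0 1"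
    and distr: "distr P borel X = uniform_measure lborel (box 0 1)"
  shows "distr P borel (\<lambda>w. inverse_cdf_map q (X w)) = target_measure"
proof (rule measure_eqI_generator_eq[where \<Omega>=UNIV and E="range (\<lambda>a. {..a})"
      and A="\<lambda>n. {..real n *\<^sub>R 1}"])
  have Y[measurable]: "(\<lambda>w. inverse_cdf_map q (X w)) \<in> borel_measurable P"
    by (rule measurable_inverse_cdf_map[OF X box])
  interpret prob_space P by fact
  interpret D: prob_space "distr P borel (\<lambda>w. inverse_cdf_map q (X w))"
    by (rule prob_space_distr[OF Y])
  show "Int_stable (range (\<lambda>a. {..a :: real ^ 'n}))" by (rule Int_stable_range_atMost_vec)
  have "sets (borel :: (real ^ 'n) measure) = sigma_sets UNIV (range (\<lambda>a. {..a}))"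
    by (subst borel_eq_atMost) (rule sets_measure_of, simp)
  then show "sets (distr P borel (\<lambda>w. inverse_cdf_map q (X w))) = sigma_sets UNIV (range (\<lambda>a. {..a}))"
    "sets target_measure = sigma_sets UNIV (range (\<lambda>a. {..a}))"
    by simp_all
  show "range (\<lambda>n. {..real n *\<^sub>R (1 :: real ^ 'n)}) \<subseteq> range (\<lambda>a. {..a})" by auto
  show "(\<Union>n. {..real n *\<^sub>R (1 :: real ^ 'n)}) = UNIV" by (rule UN_atMost_vec)
  show "emeasure (distr P borel (\<lambda>w. inverse_cdf_map q (X w))) {..real n *\<^sub>R (1 :: real ^ 'n)} \<noteq> \<infinity>" for n
    using D.emeasure_finite by simp
  show "range (\<lambda>a. {..a :: real ^ 'n}) \<subseteq> Pow UNIV" by simp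
  fix S assume "S \<in> range (\<lambda>a. {..a :: real ^ 'n})"
  then obtain a :: "real ^ 'n" where S: "S = {..a}" by auto
  let ?v = "\<chi> j. marginal_cdf j (a $ j)"
  have v: "0 \<le> ?v $ i" "?v $ i \<le> 1" for i
    using cdf_density_bounds[OF q, of i "a $ i"] by simp_all
  have m: "{x :: real ^ 'n. \<forall>i. x $ i \<le> ?v $ i} \<in> sets borel" by measurable
  have "emeasure (distr P borel (\<lambda>w. inverse_cdf_map q (X w))) {..a}
    = emeasure P ((\<lambda>w. inverse_cdf_map q (X w)) -` {..a} \<inter> space P)"
    by (rule emeasure_distr[OF Y]) simp
  also have "(\<lambda>w. inverse_cdf_map q (X w)) -` {..a} \<inter> space P = X -` {x. \<forall>i. x $ i \<le> ?v $ i} \<inter> space P"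
    using inverse_cdf_map_le_iff[OF box] by (auto simp: less_eq_vec_def)
  also have "emeasure P \<dots> = emeasure (distr P borel X) {x. \<forall>i. x $ i \<le> ?v $ i}"
    by (rule emeasure_distr[OF X m, symmetric])
  also have "\<dots> = ennreal (\<Prod>i\<in>UNIV. ?v $ i)"
    unfolding distr by (rule emeasure_uniform_box[OF v])
  finally show "emeasure (distr P borel (\<lambda>w. inverse_cdf_map q (X w))) S = emeasure target_measure S"
    by (simp add: S emeasure_target_atMost)
qed

end

section \<open>Anchored decomposition\<close>

lemma integrable_exp_neg_square:
  assumes "0 < c"
  shows "integrable lborel (\<lambda>y::real. exp (- c * y\<^sup>2))"
proof -
  \<comment> \<open>The standard deviation of the normal density with exponent
    \<open>- c * y\<^sup>2\<close>.\<close>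
  let ?s = "sqrt (1 / (2 * c))"
  have "?s\<^sup>2 = 1 / (2 * c)" using assms by simp
  then have "exp (- c * y\<^sup>2) = sqrt (2 * pi * ?s\<^sup>2) * normal_density 0 ?s y" for y
    using assms by (simp add: normal_density_def)
  then show ?thesis using assms by simp
qed

text \<open>
  Up to the null set \<open>y = x\<close>, \<open>y = 0\<close> this is \<open>1\<close> for \<open>0 < y < x\<close>, \<open>-1\<close> for \<open>x < y < 0\<close> and \<open>0\<close> elsewhere, so that
  \<open>\<phi> x - \<phi> 0\<close> is the integral of \<open>\<phi>'\<close> against it. Written as a difference of two indicators, it
  turns a product over coordinates into indicators of lower orthants.
\<close>

definition jump_kernel :: "real \<Rightarrow> real \<Rightarrow> real" where
  "jump_kernel x y = (if 0 < y then 1 else 0) - (if x < y then 1 else 0)"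

lemma jump_kernel_measurable[measurable]:
  assumes [measurable]: "f \<in> borel_measurable M" "h \<in> borel_measurable M"
  shows "(\<lambda>w. jump_kernel (f w) (h w)) \<in> borel_measurable M"
  unfolding jump_kernel_def by measurable

lemma abs_jump_kernel_le_1: "\<bar>jump_kernel x y\<bar> \<le> 1"
  by (simp add: jump_kernel_def)

text \<open>Where the kernel is nonzero, \<open>y\<close> lies between 0 and \<open>x\<close>, so
  the exponent is nonnegative. This is the pointwise form of Markov's inequality and the source of
  all decay in \<open>y\<close>.\<close>

lemma abs_jump_kernel_le_exp:
  assumes "0 \<le> \<beta>"
  shows "\<bar>jump_kernel x y\<bar> \<le> exp (\<beta> * x\<^sup>2 - \<beta> * y\<^sup>2)"
proof (cases "jump_kernel x y = 0")
  case False
  then have "\<bar>y\<bar> \<le> \<bar>x\<bar>" by (auto simp: jump_kernel_def split: if_splits)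
  then have "y\<^sup>2 \<le> x\<^sup>2" by (simp add: abs_le_square_iff)
  then have "0 \<le> \<beta> * x\<^sup>2 - \<beta> * y\<^sup>2" using assms by (simp add: mult_left_mono)
  then have "1 \<le> exp (\<beta> * x\<^sup>2 - \<beta> * y\<^sup>2)" by simp
  then show ?thesis using abs_jump_kernel_le_1[of x y] by linarith
qed simp

lemma abs_prod_jump_kernel_le_exp:
  assumes "0 \<le> \<beta>"
  shows "\<bar>\<Prod>i\<in>S. jump_kernel (x i) (y i)\<bar> \<le> exp (\<beta> * (\<Sum>i\<in>S. (x i)\<^sup>2) - \<beta> * (\<Sum>i\<in>S. (y i)\<^sup>2))"
proof (cases "finite S")
  case True
  have "\<bar>\<Prod>i\<in>S. jump_kernel (x i) (y i)\<bar> \<le> (\<Prod>i\<in>S. exp (\<beta> * (x i)\<^sup>2 - \<beta> * (y i)\<^sup>2))"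
    unfolding abs_prod by (intro prod_mono) (simp add: abs_jump_kernel_le_exp[OF assms])
  also have "\<dots> = exp (\<Sum>i\<in>S. \<beta> * (x i)\<^sup>2 - \<beta> * (y i)\<^sup>2)" using True by (simp add: exp_sum)
  finally show ?thesis by (simp add: sum_subtractf sum_distrib_left)
qed simp

text \<open>The fundamental theorem on the interval between 0 and \<open>x\<close>; for negative
  \<open>x\<close> the kernel value -1 supplies the orientation. Up to this sign, the kernel and the
  indicator of the closed interval differ at a single endpoint, which is null.\<close>

lemma integral_jump_kernel:
  assumes deriv: "\<And>t. (\<phi> has_real_derivative \<phi>' t) (at t)" and cont: "continuous_on UNIV \<phi>'"
  shows "(\<integral>t. \<phi>' t * jump_kernel x t \<partial>lborel) = \<phi> x - \<phi> 0"
proof -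
  have FTC: "(\<integral>t. \<phi>' t * indicator {a..b} t \<partial>lborel) = \<phi> b - \<phi> a" if "a \<le> b" for a b
    using that deriv cont by (intro integral_FTC_Icc_real) (auto simp: continuous_on_eq_continuous_at)
  note [measurable] = borel_measurable_continuous_onI[OF cont]
  have ne: "AE t in lborel. t \<noteq> c" for c :: real
    by (rule AE_I[where N="{c}"]) auto
  show ?thesis
  proof (cases "0 \<le> x")
    case True
    have "(\<integral>t. \<phi>' t * jump_kernel x t \<partial>lborel) = (\<integral>t. \<phi>' t * indicator {0..x} t \<partial>lborel)"
    proof (rule integral_cong_AE)
      show "AE t in lborel. \<phi>' t * jump_kernel x t = \<phi>' t * indicator {0..x} t"
        using ne[of 0] by eventually_elim (use True in \<open>auto simp: jump_kernel_def indicator_def\<close>)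
    qed measurable
    then show ?thesis using FTC[OF True] by simp
  next
    case False
    have "(\<integral>t. \<phi>' t * jump_kernel x t \<partial>lborel) = (\<integral>t. - (\<phi>' t * indicator {x..0} t) \<partial>lborel)"
    proof (rule integral_cong_AE)
      show "AE t in lborel. \<phi>' t * jump_kernel x t = - (\<phi>' t * indicator {x..0} t)"
        using ne[of x] by eventually_elim (use False in \<open>auto simp: jump_kernel_def indicator_def\<close>)
    qed measurable
    then show ?thesis using FTC[of x 0] False by simp
  qed
qed

section \<open>Integration over subsets of the coordinates\<close>

text \<open>Points over \<open>S\<close> are functions on \<open>S\<close>, so that the dimension
  can vary with \<open>S\<close> within one sum. For \<open>S = {}\<close> the space is a single
  point of mass 1, and integration is evaluation.\<close>

abbreviation lborel_on :: "'n set \<Rightarrow> ('n \<Rightarrow> real) measure" where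
  "lborel_on S \<equiv> PiM S (\<lambda>_. lborel)"

interpretation lborel_product: product_sigma_finite "\<lambda>_. lborel :: real measure" by standard

lemma integrable_gaussian_lborel_on:
  assumes "finite S" "0 < c"
  shows "integrable (lborel_on S) (\<lambda>y. exp (- c * (\<Sum>i\<in>S. (y i)\<^sup>2)))"
proof -
  have "exp (- c * (\<Sum>i\<in>S. (y i)\<^sup>2)) = (\<Prod>i\<in>S. exp (- c * (y i)\<^sup>2))" for y :: "'a \<Rightarrow> real"
    using assms by (simp add: exp_sum[symmetric] sum_distrib_left)
  then show ?thesis
    using lborel_product.product_integrable_prod[of S "\<lambda>_ t. exp (- c * t\<^sup>2)"] assms
      integrable_exp_neg_square[OF assms(2)] by simp
qed

lemma integrable_jump_kernel_prod:
  assumes S: "finite S" and H[measurable]: "H \<in> borel_measurable (lborel_on S)"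
    and bound: "\<And>y. \<bar>H y\<bar> \<le> K * exp (M * (\<Sum>i\<in>S. (y i)\<^sup>2))"
  shows "integrable (lborel_on S) (\<lambda>y. H y * (\<Prod>i\<in>S. jump_kernel (x i) (y i)))"
proof -
  \<comment> \<open>Exceeding \<open>M\<close> leaves a Gaussian of rate \<open>\<beta> - M\<close>
    in \<open>y\<close>; the maximum with 0 keeps \<beta> nonnegative, as the kernel bound requires.
    The price is an exponential in \<open>x\<close>, which is a constant here.\<close>
  define \<beta> where "\<beta> = max M 0 + 1"
  have \<beta>: "0 \<le> \<beta>" "0 < \<beta> - M" by (simp_all add: \<beta>_def)
  let ?D = "\<lambda>y. K * exp (\<beta> * (\<Sum>i\<in>S. (x i)\<^sup>2)) * exp (- (\<beta> - M) * (\<Sum>i\<in>S. (y i)\<^sup>2))"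
  have [measurable]: "(\<lambda>y. y i) \<in> borel_measurable (lborel_on S)" if "i \<in> S" for i
    using measurable_component_singleton[OF that, of "\<lambda>_. lborel"] by simp
  show ?thesis
  proof (rule Bochner_Integration.integrable_bound)
    show "integrable (lborel_on S) ?D"
      using integrable_gaussian_lborel_on[OF S \<beta>(2)] by simp
    show "(\<lambda>y. H y * (\<Prod>i\<in>S. jump_kernel (x i) (y i))) \<in> borel_measurable (lborel_on S)"
      by measurable
    have "\<bar>H y * (\<Prod>i\<in>S. jump_kernel (x i) (y i))\<bar> \<le> ?D y" for y
    proof -
      have "\<bar>H y * (\<Prod>i\<in>S. jump_kernel (x i) (y i))\<bar> \<le> K * exp (M * (\<Sum>i\<in>S. (y i)\<^sup>2))
          * exp (\<beta> * (\<Sum>i\<in>S. (x i)\<^sup>2) - \<beta> * (\<Sum>i\<in>S. (y i)\<^sup>2))"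
        unfolding abs_mult
        by (intro mult_mono bound abs_prod_jump_kernel_le_exp \<beta>) (use order_trans[OF abs_ge_zero bound] in auto)
      also have "\<dots> = ?D y" by (simp add: mult_exp_exp algebra_simps)
      finally show ?thesis .
    qed
    then show "AE y in lborel_on S. norm (H y * (\<Prod>i\<in>S. jump_kernel (x i) (y i))) \<le> norm (?D y)"
      by (intro AE_I2) (smt (verit) real_norm_def)
  qed
qed

section \<open>Differentiation and integration along one coordinate\<close>

lemma C_diff_continuous: "C_diff k f \<Longrightarrow> continuous_on UNIV f"
  by (cases k) auto

lemma C_diff_Suc_imp: "C_diff (Suc k) f \<Longrightarrow> C_diff k f"
proof (induction k arbitrary: f)
  case (Suc k)
  then show ?case by simp
qed auto

text \<open>\<open>C_diff\<close> speaks of differentiability at parameter 0 only, but for every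
  base point; moving the base point along the line gives the derivative at every
  \<open>t\<close>.\<close>

lemma partial_deriv_has_derivative:
  fixes h :: "real ^ 'n::finite \<Rightarrow> real"
  assumes h: "C_diff (Suc k) h"
  shows "((\<lambda>t. h (\<chi> j. if j = i then t else x $ j)) has_real_derivative
    partial_deriv i h (\<chi> j. if j = i then t else x $ j)) (at t)"
proof -
  let ?z = "\<lambda>t. \<chi> j. if j = i then t else x $ j"
  have shift: "?z t + s *\<^sub>R axis i 1 = ?z (s + t)" for s
    by (simp add: vec_eq_iff axis_def)
  have "(\<lambda>s. h (?z t + s *\<^sub>R axis i 1)) differentiable (at 0)" using h by simp
  then have "((\<lambda>s. h (?z t + s *\<^sub>R axis i 1)) has_real_derivative partial_deriv i h (?z t)) (at 0)"
    unfolding partial_deriv_def DERIV_deriv_iff_real_differentiable .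
  then have "((\<lambda>s. h (?z (s + t))) has_real_derivative partial_deriv i h (?z t)) (at 0)"
    by (simp only: shift)
  then show ?thesis
    using DERIV_shift[of "\<lambda>t. h (?z t)" "partial_deriv i h (?z t)" 0 t] by simp
qed

lemma continuous_on_coordinate_update:
  fixes h :: "real ^ 'n::finite \<Rightarrow> real"
  assumes "continuous_on UNIV h"
  shows "continuous_on UNIV (\<lambda>t. h (\<chi> j. if j = i then t else x $ j))"
proof (rule continuous_on_compose2[OF assms])
  have "continuous_on UNIV (\<lambda>t. if j = i then t else x $ j)" for j
    by (cases "j = i") simp_all
  then show "continuous_on UNIV (\<lambda>t. \<chi> j. if j = i then t else x $ j)"
    by (rule continuous_on_vec_lambda)
qed simp

lemma integral_partial_deriv_jump_kernel:
  fixes h :: "real ^ 'n::finite \<Rightarrow> real"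
  assumes h: "C_diff (Suc k) h"
  shows "(\<integral>t. partial_deriv i h (\<chi> j. if j = i then t else x $ j) * jump_kernel a t \<partial>lborel)
    = h (\<chi> j. if j = i then a else x $ j) - h (\<chi> j. if j = i then 0 else x $ j)"
proof -
  have "C_diff k (partial_deriv i h)" using h by simp
  from continuous_on_coordinate_update[OF C_diff_continuous[OF this]] show ?thesis
    by (intro integral_jump_kernel[where \<phi>="\<lambda>t. h (\<chi> j. if j = i then t else x $ j)"]
        partial_deriv_has_derivative[OF h])
qed

section \<open>Mixed derivatives and the anchored expansion\<close>

text \<open>The operator of \<open>multi_deriv\<close> with exponents 0 and 1, but along any list. A
  right fold applies the head of the list last, so an expansion that extends a suffix of
  \<open>coord_enum\<close> at its head always puts the new derivative outermost.\<close>

definition mixed_deriv :: "'n::finite set \<Rightarrow> 'n list \<Rightarrow> (real ^ 'n \<Rightarrow> real) \<Rightarrow> real ^ 'n \<Rightarrow> real" where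
  "mixed_deriv S js g = foldr (\<lambda>i. partial_deriv i ^^ (if i \<in> S then 1 else 0)) js g"

lemma mixed_deriv_Nil[simp]: "mixed_deriv S [] g = g"
  by (simp add: mixed_deriv_def)

lemma mixed_deriv_Cons:
  "mixed_deriv S (i # js) g = (if i \<in> S then partial_deriv i (mixed_deriv S js g) else mixed_deriv S js g)"
  by (simp add: mixed_deriv_def)

lemma mixed_deriv_insert: "i \<notin> set js \<Longrightarrow> mixed_deriv (insert i S) js g = mixed_deriv S js g"
  by (induction js) (auto simp: mixed_deriv_Cons)

lemma mixed_deriv_append: "S \<inter> set ks = {} \<Longrightarrow> mixed_deriv S (ks @ js) g = mixed_deriv S js g"
  by (induction ks) (auto simp: mixed_deriv_Cons)

text \<open>Each entry of the list uses up at most one order of differentiability; an entry outside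
  \<open>S\<close> uses none, and the order is then lowered to keep the count uniform.\<close>

lemma C_diff_mixed_deriv:
  "C_diff n g \<Longrightarrow> length js \<le> n \<Longrightarrow> C_diff (n - length js) (mixed_deriv S js g)"
proof (induction js)
  case (Cons i js)
  then have "C_diff (Suc (n - length (i # js))) (mixed_deriv S js g)" by (simp add: Suc_diff_Suc)
  then show ?case
    using C_diff_Suc_imp by (auto simp: mixed_deriv_Cons simp del: list.size)
qed simp

text \<open>\<open>T\<close> is the set of coordinates already expanded, \<open>S \<subseteq> T\<close> those among them being integrated over.\<close>

definition overlay :: "'n::finite set \<Rightarrow> 'n set \<Rightarrow> ('n \<Rightarrow> real) \<Rightarrow> real ^ 'n \<Rightarrow> real ^ 'n" where
  "overlay S T y x = (\<chi> i. if i \<in> S then y i else if i \<in> T then 0 else x $ i)"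

lemma norm_vec_square: "(norm x)\<^sup>2 = (\<Sum>i\<in>UNIV. (x $ i)\<^sup>2)" for x :: "real ^ 'n::finite"
  unfolding power2_norm_eq_inner inner_vec_def by (simp add: power2_eq_square)

lemma norm_overlay_square:
  assumes "S \<subseteq> T"
  shows "(norm (overlay S T y x))\<^sup>2 = (\<Sum>i\<in>S. (y i)\<^sup>2) + (\<Sum>i\<in>-T. (x $ i)\<^sup>2)"
proof -
  have "(overlay S T y x $ i)\<^sup>2 = (if i \<in> S then (y i)\<^sup>2 else 0) + (if i \<in> - T then (x $ i)\<^sup>2 else 0)" for i
    using assms by (auto simp: overlay_def)
  then show ?thesis
    unfolding norm_vec_square by (simp only: sum.distrib) (simp add: sum.If_cases Compl_eq)
qed

lemma measurable_overlay[measurable]: "(\<lambda>y. overlay S T y x) \<in> borel_measurable (lborel_on S)"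
proof -
  have [measurable]: "(\<lambda>y. y i) \<in> borel_measurable (lborel_on S)" if "i \<in> S" for i
    using measurable_component_singleton[OF that, of "\<lambda>_. lborel"] by simp
  have "(\<lambda>y. overlay S T y x $ i) \<in> borel_measurable (lborel_on S)" for i
    by (cases "i \<in> S") (simp_all add: overlay_def)
  then show ?thesis
    by (subst borel_measurable_euclidean_space)
      (auto simp: Basis_vec_def cart_eq_inner_axis[symmetric])
qed

definition anchored_term ::
  "(real ^ 'n::finite \<Rightarrow> real) \<Rightarrow> 'n list \<Rightarrow> 'n set \<Rightarrow> real ^ 'n \<Rightarrow> ('n \<Rightarrow> real) \<Rightarrow> real" where
  "anchored_term g js S x y
    = mixed_deriv S js g (overlay S (set js) y x) * (\<Prod>i\<in>S. jump_kernel (x $ i) (y i))"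

locale growth_function =
  fixes g :: "real ^ 'n::finite \<Rightarrow> real" and M C :: real
  assumes smooth: "C_diff CARD('n) g"
    and growth: "\<And>a x. (\<Sum>i\<in>UNIV. a i) \<le> CARD('n) \<Longrightarrow> \<bar>multi_deriv a g x\<bar> \<le> C * exp (M * (norm x)\<^sup>2)"
begin

text \<open>Coordinates in the prefix \<open>ks\<close> lie outside \<open>S\<close> and leave the
  function alone, so this is a \<open>multi_deriv\<close> with exponents 0 and 1, of total order
  \<open>card S\<close>.\<close>

lemma mixed_deriv_growth:
  assumes "coord_enum = ks @ js" "S \<subseteq> set js"
  shows "\<bar>mixed_deriv S js g x\<bar> \<le> C * exp (M * (norm x)\<^sup>2)"
proof -
  have "distinct (ks @ js)" using coord_enum(1) assms by metis
  then have "S \<inter> set ks = {}" using assms(2) by auto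
  then have "mixed_deriv S js g = mixed_deriv S coord_enum g"
    unfolding assms(1) by (rule mixed_deriv_append[symmetric])
  also have "\<dots> = multi_deriv (\<lambda>i. if i \<in> S then 1 else 0) g"
    by (simp add: mixed_deriv_def multi_deriv_def)
  finally show ?thesis
    using growth[of "\<lambda>i. if i \<in> S then 1 else 0" x] by (simp add: sum.If_cases card_mono)
qed

lemma continuous_mixed_deriv:
  assumes "coord_enum = ks @ js"
  shows "continuous_on UNIV (mixed_deriv S js g)"
proof -
  have "length (coord_enum :: 'n list) = CARD('n)" by (metis coord_enum distinct_card)
  then have "length js \<le> CARD('n)" using arg_cong[OF assms, of length] by simp
  from C_diff_continuous[OF C_diff_mixed_deriv[OF smooth this]] show ?thesis .
qed

lemma integrable_anchored_term:
  assumes "coord_enum = ks @ js" "S \<subseteq> set js"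
  shows "integrable (lborel_on S) (anchored_term g js S x)"
  unfolding anchored_term_def
proof (rule integrable_jump_kernel_prod)
  note [measurable] = borel_measurable_continuous_onI[OF continuous_mixed_deriv[OF assms(1)]]
  show "(\<lambda>y. mixed_deriv S js g (overlay S (set js) y x)) \<in> borel_measurable (lborel_on S)"
    by measurable
  show "\<bar>mixed_deriv S js g (overlay S (set js) y x)\<bar>
    \<le> (C * exp (M * (\<Sum>i\<in>-set js. (x $ i)\<^sup>2))) * exp (M * (\<Sum>i\<in>S. (y i)\<^sup>2))" for y
    using mixed_deriv_growth[OF assms, of "overlay S (set js) y x"]
    by (simp add: norm_overlay_square[OF assms(2)] exp_add algebra_simps)
qed simp

text \<open>The fundamental theorem in coordinate \<open>i\<close>: by Fubini the term for
  \<open>insert i S\<close> has an inner integral of a derivative in direction \<open>i\<close>. It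
  evaluates to the value at \<open>x $ i\<close>, which belongs to the unsplit term, minus the value
  at 0, which belongs to the term anchored in \<open>i\<close>.\<close>

lemma anchored_term_split:
  assumes enum: "coord_enum = ks @ i # js" and S: "S \<subseteq> set js"
  shows "(\<integral>y. anchored_term g js S x y \<partial>lborel_on S)
    = (\<integral>y. anchored_term g (i # js) S x y \<partial>lborel_on S)
      + (\<integral>y. anchored_term g (i # js) (insert i S) x y \<partial>lborel_on (insert i S))"
proof -
  have "distinct (ks @ i # js)" using coord_enum(1) enum by metis
  then have i: "i \<notin> set js" "i \<notin> S" using S by auto
  have "length (coord_enum :: 'n list) = CARD('n)" by (metis coord_enum distinct_card)
  then have len: "length (i # js) \<le> CARD('n)" using arg_cong[OF enum, of length] by simp
  let ?h = "mixed_deriv S js g"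
  have C: "C_diff (Suc (CARD('n) - length (i # js))) ?h"
    using C_diff_mixed_deriv[OF smooth, of js S] len by (simp add: Suc_diff_Suc)
  have D: "mixed_deriv (insert i S) (i # js) g = partial_deriv i ?h"
    using i by (simp add: mixed_deriv_Cons mixed_deriv_insert)
  have D': "mixed_deriv S (i # js) g = ?h" using i by (simp add: mixed_deriv_Cons)
  have enum': "coord_enum = (ks @ [i]) @ js" using enum by simp
  have "(\<integral>y. anchored_term g (i # js) (insert i S) x y \<partial>lborel_on (insert i S))
    = (\<integral>y. (\<integral>t. anchored_term g (i # js) (insert i S) x (y(i := t)) \<partial>lborel) \<partial>lborel_on S)"
    using i S by (intro lborel_product.product_integral_insert integrable_anchored_term[OF enum]) auto
  also have "\<dots> = (\<integral>y. anchored_term g js S x y - anchored_term g (i # js) S x y \<partial>lborel_on S)"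
  proof (rule Bochner_Integration.integral_cong[OF refl])
    fix y
    let ?K = "\<Prod>j\<in>S. jump_kernel (x $ j) (y j)"
    let ?w = "\<lambda>t. \<chi> j. if j = i then t else overlay S (set js) y x $ j"
    have K: "(\<Prod>j\<in>insert i S. jump_kernel (x $ j) ((y(i := t)) j)) = jump_kernel (x $ i) t * ?K" for t
      using i by (subst prod.insert) (auto intro!: prod.cong arg_cong2[where f="(*)"])
    \<comment> \<open>The points of evaluation differ in coordinate \<open>i\<close> only, which is
      integrated (\<open>t\<close>), anchored (0) or not yet expanded
      (\<open>x $ i\<close>).\<close>
    have w: "overlay (insert i S) (set (i # js)) (y(i := t)) x = ?w t" for t
      using i by (auto simp: overlay_def vec_eq_iff)
    have w0: "overlay S (set (i # js)) y x = ?w 0" "overlay S (set js) y x = ?w (x $ i)"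
      using i by (auto simp: overlay_def vec_eq_iff)
    have "(\<integral>t. anchored_term g (i # js) (insert i S) x (y(i := t)) \<partial>lborel)
      = (\<integral>t. (partial_deriv i ?h (?w t) * jump_kernel (x $ i) t) * ?K \<partial>lborel)"
      unfolding anchored_term_def K w D by (simp add: mult_ac)
    also have "\<dots> = (?h (?w (x $ i)) - ?h (?w 0)) * ?K"
      by (simp add: integral_partial_deriv_jump_kernel[OF C])
    also have "\<dots> = anchored_term g js S x y - anchored_term g (i # js) S x y"
      unfolding anchored_term_def D' w0[symmetric] by (simp add: algebra_simps)
    finally show "(\<integral>t. anchored_term g (i # js) (insert i S) x (y(i := t)) \<partial>lborel)
      = anchored_term g js S x y - anchored_term g (i # js) S x y" .
  qed
  also have "\<dots> = (\<integral>y. anchored_term g js S x y \<partial>lborel_on S)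
      - (\<integral>y. anchored_term g (i # js) S x y \<partial>lborel_on S)"
    using S by (intro Bochner_Integration.integral_diff integrable_anchored_term[OF enum]
        integrable_anchored_term[OF enum']) auto
  finally show ?thesis by simp
qed

text \<open>Induction from the end of the enumeration. Prepending \<open>i\<close> splits every term
  in two, according to whether \<open>i\<close> joins \<open>S\<close>, and so turns the subsets of
  the old suffix into those of the new one. The empty suffix leaves \<open>g x\<close>, integrated
  over a one-point space.\<close>

lemma anchored_decomposition_suffix:
  "coord_enum = ks @ js \<Longrightarrow> g x = (\<Sum>S\<in>Pow (set js). \<integral>y. anchored_term g js S x y \<partial>lborel_on S)"
proof (induction js arbitrary: ks)
  case Nil
  have "overlay {} {} y x = x" for y by (simp add: overlay_def vec_eq_iff)
  then show ?case
    by (simp add: anchored_term_def PiM_empty lebesgue_integral_count_space_finite)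
next
  case (Cons i js)
  have "distinct (ks @ i # js)" using coord_enum(1) Cons.prems by metis
  then have i: "i \<notin> set js" by auto
  let ?I = "\<lambda>S. \<integral>y. anchored_term g (i # js) S x y \<partial>lborel_on S"
  have "g x = (\<Sum>S\<in>Pow (set js). \<integral>y. anchored_term g js S x y \<partial>lborel_on S)"
    using Cons.IH[of "ks @ [i]"] Cons.prems by simp
  also have "\<dots> = (\<Sum>S\<in>Pow (set js). ?I S + ?I (insert i S))"
    using anchored_term_split[OF Cons.prems] by (intro sum.cong) auto
  also have "\<dots> = (\<Sum>S\<in>Pow (set js). ?I S) + (\<Sum>S\<in>insert i ` Pow (set js). ?I S)"
    using i by (subst sum.reindex) (auto simp: sum.distrib inj_on_def o_def)
  also have "\<dots> = (\<Sum>S\<in>Pow (set (i # js)). ?I S)"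
    unfolding list.set Pow_insert using i by (intro sum.union_disjoint[symmetric]) auto
  finally show ?case .
qed

end

section \<open>Discrepancy of the kernel products\<close>

text \<open>All local discrepancies lie in [-1,1]; this boundedness makes the real-valued supremum
  an actual upper bound.\<close>

lemma local_discrepancy_le_star_discrepancy:
  fixes w :: "nat \<Rightarrow> real ^ 'n::finite"
  assumes z: "z \<in> box 0 1"
  shows "\<bar>(1 / real N) * (\<Sum>i=1..N. indicator {v. \<forall>j. 0 \<le> v $ j \<and> v $ j < z $ j} (w i))
        - (\<Prod>j\<in>UNIV. z $ j)\<bar> \<le> star_discrepancy N w"
  unfolding star_discrepancy_def
proof (rule cSUP_upper[OF z], rule bdd_aboveI2)
  fix z :: "real ^ 'n" assume z: "z \<in> box 0 1"
  let ?S = "(\<Sum>i=1..N. indicator {v. \<forall>j. 0 \<le> v $ j \<and> v $ j < z $ j} (w i)) :: real"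
  have "?S \<le> (\<Sum>i=1..N. 1)" by (intro sum_mono) (simp add: indicator_def)
  moreover have "0 \<le> ?S" by (intro sum_nonneg) simp
  ultimately have "0 \<le> (1 / real N) * ?S" "(1 / real N) * ?S \<le> 1"
    by (cases "N = 0"; simp)+
  moreover have "0 \<le> (\<Prod>j\<in>UNIV. z $ j)" "(\<Prod>j\<in>UNIV. z $ j) \<le> 1"
    using z by (auto simp: mem_box_cart less_imp_le intro!: prod_nonneg prod_le_1)
  ultimately show "\<bar>(1 / real N) * ?S - (\<Prod>j\<in>UNIV. z $ j)\<bar> \<le> 1" by linarith
qed

text \<open>
  The supremum in the star discrepancy is over the open cube; boxes with some sides equal to \<open>1\<close> are
  reached as a limit.
\<close>

lemma face_discrepancy_le_star_discrepancy:
  fixes w :: "nat \<Rightarrow> real ^ 'n::finite"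
  assumes w: "\<And>k. k \<in> {1..N} \<Longrightarrow> w k \<in> box 0 1"
    and v: "\<And>i. i \<in> R \<Longrightarrow> 0 < v i \<and> v i < 1"
  shows "\<bar>(1 / real N) * (\<Sum>k=1..N. \<Prod>i\<in>R. if w k $ i < v i then 1 else 0) - (\<Prod>i\<in>R. v i)\<bar>
    \<le> star_discrepancy N w"
proof -
  let ?z = "\<lambda>t. \<chi> i. if i \<in> R then v i else 1 - t"
  let ?E = "(1 / real N) * (\<Sum>k=1..N. \<Prod>i\<in>R. if w k $ i < v i then 1 else 0)"
  \<comment> \<open>Finitely many points have all coordinates below 1, so for small \<open>t\<close>
    the sides \<open>1 - t\<close> cut off none of them: the counts are already those of the box
    with full sides, and only the volume still depends on \<open>t\<close>.\<close>
  have "eventually (\<lambda>t. \<forall>k\<in>{1..N}. \<forall>i. w k $ i < 1 - t) (at_right 0)"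
  proof (intro eventually_ball_finite eventually_all_finite ballI)
    fix k i assume "k \<in> {1..N}"
    then have "w k $ i < 1" using w by (auto simp: mem_box_cart)
    moreover have "((\<lambda>t. 1 - t) \<longlongrightarrow> 1 - 0) (at_right (0::real))" by (intro tendsto_intros)
    ultimately show "eventually (\<lambda>t. w k $ i < 1 - t) (at_right 0)" by (auto dest: order_tendstoD)
  qed simp
  moreover have "eventually (\<lambda>t. t \<in> {0<..<1}) (at_right (0::real))"
    by (rule eventually_at_right_real) simp
  ultimately have "eventually (\<lambda>t. \<bar>?E - (\<Prod>j\<in>UNIV. ?z t $ j)\<bar> \<le> star_discrepancy N w) (at_right 0)"
  proof eventually_elim
    case (elim t)
    have "?z t \<in> box 0 1" using elim v by (auto simp: mem_box_cart)
    moreover have "indicator {x. \<forall>j. 0 \<le> x $ j \<and> x $ j < ?z t $ j} (w k)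
        = (\<Prod>i\<in>R. if w k $ i < v i then 1 else 0 :: real)" if k: "k \<in> {1..N}" for k
    proof (cases "\<forall>i\<in>R. w k $ i < v i")
      case True
      then have "\<forall>j. 0 \<le> w k $ j \<and> w k $ j < ?z t $ j"
        using w[OF k] elim k by (auto simp: mem_box_cart less_imp_le)
      then show ?thesis using True by simp
    next
      case False
      then obtain i where i: "i \<in> R" "\<not> w k $ i < v i" by blast
      then have "(\<Prod>i\<in>R. if w k $ i < v i then 1 else 0 :: real) = 0" by (intro prod_zero) auto
      moreover have "\<not> w k $ i < ?z t $ i" using i by simp
      ultimately show ?thesis by (auto simp: indicator_def)
    qed
    ultimately show ?case
      using local_discrepancy_le_star_discrepancy[of "?z t" N w] by simp
  qed
  moreover have "((\<lambda>t. \<bar>?E - (\<Prod>j\<in>UNIV. ?z t $ j)\<bar>) \<longlongrightarrow> \<bar>?E - (\<Prod>j\<in>UNIV. if j \<in> R then v j else 1 - 0)\<bar>)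
      (at_right (0::real))"
  proof (intro tendsto_intros)
    fix j show "((\<lambda>t. ?z t $ j) \<longlongrightarrow> (if j \<in> R then v j else 1 - 0)) (at_right (0::real))"
      by (cases "j \<in> R") (auto intro!: tendsto_eq_intros)
  qed
  ultimately have "\<bar>?E - (\<Prod>j\<in>UNIV. if j \<in> R then v j else 1 - 0)\<bar> \<le> star_discrepancy N w"
    by (intro tendsto_upperbound) auto
  then show ?thesis by (simp add: prod.If_cases)
qed

section \<open>Kernel products under the empirical and the target law\<close>

context positive_product_density
begin

text \<open>Coordinates outside \<open>R\<close> are free and contribute mass 1; the strict bounds
  have the same mass as weak ones because the marginals have no atoms.\<close>

lemma integral_target_lower_orthant:
  "(\<integral>x. (\<Prod>i\<in>R. if x $ i < y i then 1 else 0) \<partial>target_measure) = (\<Prod>i\<in>R. marginal_cdf i (y i))"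
  and integrable_target_lower_orthant:
  "integrable target_measure (\<lambda>x. (\<Prod>i\<in>R. if x $ i < y i then 1 else 0 :: real))"
proof -
  let ?D = "\<lambda>i. if i \<in> R then {..<y i} else UNIV"
  have e: "emeasure (density lborel (\<lambda>x. ennreal (q i x))) (?D i)
    = ennreal (if i \<in> R then marginal_cdf i (y i) else 1)" for i
  proof -
    interpret real_distribution "density lborel (\<lambda>x. ennreal (q i x))"
      by (rule real_distribution_density[OF q])
    show ?thesis using prob_space by (simp add: emeasure_eq_measure measure_density_lessThan[OF q])
  qed
  interpret prob_space target_measure by (rule prob_space_target)
  let ?A = "{x :: real ^ 'n. \<forall>i. x $ i \<in> ?D i}"
  have A: "?A = {x. \<forall>i\<in>R. x $ i < y i}" by auto
  have [measurable]: "?A \<in> sets borel" unfolding A by measurable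
  have ind: "(\<Prod>i\<in>R. if x $ i < y i then 1 else 0) = indicat_real ?A x" for x
  proof (cases "\<forall>i\<in>R. x $ i < y i")
    case True
    then show ?thesis by (simp add: A)
  next
    case False
    then have "(\<Prod>i\<in>R. if x $ i < y i then 1 else 0 :: real) = 0" by (intro prod_zero) auto
    then show ?thesis using False by (auto simp: A)
  qed
  show "integrable target_measure (\<lambda>x. (\<Prod>i\<in>R. if x $ i < y i then 1 else 0 :: real))"
    unfolding ind by (intro integrable_real_indicator) (auto simp: less_top[symmetric])
  have "emeasure target_measure ?A = (\<Prod>i\<in>UNIV. ennreal (if i \<in> R then marginal_cdf i (y i) else 1))"
    by (subst emeasure_target_prod) (auto simp: e)
  also have "\<dots> = ennreal (\<Prod>i\<in>R. marginal_cdf i (y i))"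
    using cdf_density_bounds(1)[OF q] by (subst prod_ennreal) (auto simp: prod.If_cases less_imp_le)
  finally have "measure target_measure ?A = (\<Prod>i\<in>R. marginal_cdf i (y i))"
    using cdf_density_bounds(1)[OF q] by (simp add: measure_def prod_nonneg less_imp_le)
  then show "(\<integral>x. (\<Prod>i\<in>R. if x $ i < y i then 1 else 0) \<partial>target_measure) = (\<Prod>i\<in>R. marginal_cdf i (y i))"
    unfolding ind by simp
qed

definition kernel_discrepancy :: "nat \<Rightarrow> (nat \<Rightarrow> real ^ 'n) \<Rightarrow> 'n set \<Rightarrow> ('n \<Rightarrow> real) \<Rightarrow> real" where
  "kernel_discrepancy N X S y = (1 / real N) * (\<Sum>k=1..N. \<Prod>i\<in>S. jump_kernel (X k $ i) (y i))
    - (\<integral>x. (\<Prod>i\<in>S. jump_kernel (x $ i) (y i)) \<partial>target_measure)"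

text \<open>Each kernel is a difference of two indicators; in the expanded product, \<open>R\<close>
  collects the factors that contribute the one depending on \<open>x\<close>. Each of the at most
  \<open>2 ^ CARD('n)\<close> terms is then the discrepancy of an anchored box, with a coefficient
  of modulus at most 1.\<close>

lemma abs_kernel_discrepancy_le_star_discrepancy:
  assumes w: "\<And>k. k \<in> {1..N} \<Longrightarrow> w k \<in> box 0 1"
  shows "\<bar>kernel_discrepancy N (\<lambda>k. inverse_cdf_map q (w k)) S y\<bar> \<le> 2 ^ CARD('n) * star_discrepancy N w"
proof -
  let ?a = "\<lambda>i. if 0 < y i then 1 else 0 :: real"
  let ?c = "\<lambda>R. (-1) ^ card R * (\<Prod>i\<in>S-R. ?a i)"
  let ?J = "\<lambda>x R. \<Prod>i\<in>R. if x $ i < y i then 1 else 0 :: real"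
  have K: "(\<Prod>i\<in>S. jump_kernel (x $ i) (y i)) = (\<Sum>R\<in>Pow S. ?c R * ?J x R)" for x :: "real ^ 'n"
    unfolding jump_kernel_def by (subst prod_diff_conv_sum) (simp_all add: mult_ac)
  let ?d = "\<lambda>R. (1 / real N) * (\<Sum>k=1..N. ?J (inverse_cdf_map q (w k)) R) - (\<Prod>i\<in>R. marginal_cdf i (y i))"
  have "kernel_discrepancy N (\<lambda>k. inverse_cdf_map q (w k)) S y = (\<Sum>R\<in>Pow S. ?c R * ?d R)"
  proof -
    have "(\<integral>x. (\<Prod>i\<in>S. jump_kernel (x $ i) (y i)) \<partial>target_measure)
      = (\<Sum>R\<in>Pow S. ?c R * (\<Prod>i\<in>R. marginal_cdf i (y i)))"
      unfolding K using integrable_target_lower_orthant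
      by (subst Bochner_Integration.integral_sum) (simp_all add: integral_target_lower_orthant)
    moreover have "(1 / real N) * (\<Sum>k=1..N. \<Prod>i\<in>S. jump_kernel (inverse_cdf_map q (w k) $ i) (y i))
      = (\<Sum>R\<in>Pow S. ?c R * ((1 / real N) * (\<Sum>k=1..N. ?J (inverse_cdf_map q (w k)) R)))"
      unfolding K by (subst sum.swap) (simp add: sum_distrib_left mult_ac)
    ultimately show ?thesis
      unfolding kernel_discrepancy_def by (simp add: sum_subtractf right_diff_distrib)
  qed
  also have "\<bar>\<dots>\<bar> \<le> (\<Sum>R\<in>Pow S. star_discrepancy N w)"
  proof (rule order_trans[OF sum_abs sum_mono])
    fix R
    have "?J (inverse_cdf_map q (w k)) R = (\<Prod>i\<in>R. if w k $ i < marginal_cdf i (y i) then 1 else 0)"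
      if "k \<in> {1..N}" for k
      by (simp add: inverse_cdf_map_less_iff[OF w[OF that]])
    then have "\<bar>?d R\<bar> \<le> star_discrepancy N w"
      using face_discrepancy_le_star_discrepancy[of N w R "\<lambda>i. marginal_cdf i (y i)"] w
        cdf_density_bounds[OF q] by simp
    moreover have "\<bar>?c R\<bar> \<le> 1"
      by (auto simp: abs_mult power_abs abs_prod intro!: prod_le_1)
    ultimately show "\<bar>?c R * ?d R\<bar> \<le> star_discrepancy N w"
      using mult_mono[of "\<bar>?c R\<bar>" 1 "\<bar>?d R\<bar>" "star_discrepancy N w"]
      by (simp add: abs_mult)
  qed
  also have "\<dots> = 2 ^ card S * star_discrepancy N w" by (simp add: card_Pow)
  also have "\<dots> \<le> 2 ^ CARD('n) * star_discrepancy N w"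
    \<comment> \<open>For \<open>R = {}\<close> the star discrepancy bounds an absolute value; it is
      therefore nonnegative, and the number of terms may be enlarged.\<close>
    using order_trans[OF abs_ge_zero face_discrepancy_le_star_discrepancy[of N w "{}", OF w]]
    by (intro mult_right_mono power_increasing card_mono) auto
  finally show ?thesis .
qed

end

section \<open>Pathwise error bound\<close>

lemma (in pair_sigma_finite) integrable_pair_mult:
  fixes f h :: "_ \<Rightarrow> real"
  assumes f: "integrable M1 f" and h: "integrable M2 h"
  shows "integrable (M1 \<Otimes>\<^sub>M M2) (\<lambda>z. f (fst z) * h (snd z))"
proof (rule Fubini_integrable)
  have [measurable]: "f \<in> borel_measurable M1" "h \<in> borel_measurable M2" using assms by auto
  show "(\<lambda>z. f (fst z) * h (snd z)) \<in> borel_measurable (M1 \<Otimes>\<^sub>M M2)" by measurable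
  show "integrable M1 (\<lambda>x. \<integral>y. norm (f (fst (x, y)) * h (snd (x, y))) \<partial>M2)"
    using f by (simp add: abs_mult)
  show "AE x in M1. integrable M2 (\<lambda>y. f (fst (x, y)) * h (snd (x, y)))"
    using h by simp
qed

text \<open>\<beta> is an exponent at which the target has a finite exponential moment. Exceeding
  \<open>M\<close>, it makes \<open>g\<close> integrable and outweighs the growth of its
  derivatives. It will be 0 for negative \<open>M\<close> and otherwise lie below the tail
  exponent.\<close>

locale rqmc_error = positive_product_density q + growth_function g M C
  for q :: "'n::finite \<Rightarrow> real \<Rightarrow> real" and g :: "real ^ 'n \<Rightarrow> real" and M C +
  fixes \<beta> :: real
  assumes \<beta>_nonneg: "0 \<le> \<beta>" and M_less: "M < \<beta>"
    and integrable_exp: "integrable target_measure (\<lambda>x. exp (\<beta> * (norm x)\<^sup>2))"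
begin

sublocale target: prob_space target_measure by (rule prob_space_target)

abbreviation kernel_prod :: "'n set \<Rightarrow> real ^ 'n \<Rightarrow> ('n \<Rightarrow> real) \<Rightarrow> real" where
  "kernel_prod S x y \<equiv> \<Prod>i\<in>S. jump_kernel (x $ i) (y i)"

text \<open>The argument 0 of \<open>overlay\<close> is a placeholder: once all coordinates are
  expanded, none is read from it, so this factor is independent of the sample point.\<close>

definition anchored_deriv :: "'n set \<Rightarrow> ('n \<Rightarrow> real) \<Rightarrow> real" where
  "anchored_deriv S y = mixed_deriv S coord_enum g (overlay S UNIV y 0)"

lemma anchored_term_eq: "anchored_term g coord_enum S x y = anchored_deriv S y * kernel_prod S x y"
proof -
  have "overlay S UNIV y x = overlay S UNIV y 0" by (simp add: overlay_def vec_eq_iff)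
  then show ?thesis by (simp add: anchored_term_def anchored_deriv_def coord_enum)
qed

lemma abs_anchored_deriv_le: "\<bar>anchored_deriv S y\<bar> \<le> C * exp (M * (\<Sum>i\<in>S. (y i)\<^sup>2))"
  using mixed_deriv_growth[of "[]" coord_enum S "overlay S UNIV y 0"]
  by (simp add: anchored_deriv_def coord_enum norm_overlay_square)

lemma measurable_anchored_deriv[measurable]: "anchored_deriv S \<in> borel_measurable (lborel_on S)"
proof -
  note [measurable] = borel_measurable_continuous_onI[OF continuous_mixed_deriv[of "[]" coord_enum S]]
  show ?thesis unfolding anchored_deriv_def[abs_def] by simp
qed

lemma abs_g_le: "\<bar>g x\<bar> \<le> C * exp (M * (norm x)\<^sup>2)"
  using mixed_deriv_growth[of coord_enum "[]" "{}" x] by simp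

lemma C_nonneg: "0 \<le> C"
  using order_trans[OF abs_ge_zero abs_g_le[of 0]] by simp

lemma measurable_g[measurable]: "g \<in> borel_measurable borel"
  by (intro borel_measurable_continuous_onI C_diff_continuous[OF smooth])

lemma sum_square_le_norm: "(\<Sum>i\<in>S. (x $ i)\<^sup>2) \<le> (norm x)\<^sup>2" for x :: "real ^ 'n"
  unfolding norm_vec_square by (intro sum_mono2) auto

lemma abs_kernel_prod_le:
  "\<bar>kernel_prod S x y\<bar> \<le> exp (\<beta> * (norm x)\<^sup>2) * exp (- \<beta> * (\<Sum>i\<in>S. (y i)\<^sup>2))"
proof -
  have "\<beta> * (\<Sum>i\<in>S. (x $ i)\<^sup>2) \<le> \<beta> * (norm x)\<^sup>2"
    by (intro mult_left_mono sum_square_le_norm \<beta>_nonneg)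
  then have "exp (\<beta> * (\<Sum>i\<in>S. (x $ i)\<^sup>2) - \<beta> * (\<Sum>i\<in>S. (y i)\<^sup>2))
      \<le> exp (\<beta> * (norm x)\<^sup>2 + - \<beta> * (\<Sum>i\<in>S. (y i)\<^sup>2))" by simp
  with abs_prod_jump_kernel_le_exp[OF \<beta>_nonneg] show ?thesis
    unfolding exp_add by (rule order_trans)
qed

lemma integrable_target_g: "integrable target_measure g"
proof (rule Bochner_Integration.integrable_bound)
  show "integrable target_measure (\<lambda>x. C * exp (\<beta> * (norm x)\<^sup>2))" using integrable_exp by simp
  have "\<bar>g x\<bar> \<le> C * exp (\<beta> * (norm x)\<^sup>2)" for x
  proof -
    have "C * exp (M * (norm x)\<^sup>2) \<le> C * exp (\<beta> * (norm x)\<^sup>2)"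
      using M_less C_nonneg by (intro mult_left_mono) (simp_all add: mult_right_mono)
    then show ?thesis using abs_g_le[of x] by linarith
  qed
  then show "AE x in target_measure. norm (g x) \<le> norm (C * exp (\<beta> * (norm x)\<^sup>2))"
    using C_nonneg by (intro AE_I2) simp
qed simp

lemma integrable_anchored_kernel: "integrable (lborel_on S) (\<lambda>y. anchored_deriv S y * kernel_prod S x y)"
  using integrable_anchored_term[of "[]" coord_enum S x]
  by (simp add: coord_enum anchored_term_eq[abs_def])

lemma g_anchored_decomposition:
  "g x = (\<Sum>S\<in>UNIV. \<integral>y. anchored_deriv S y * kernel_prod S x y \<partial>lborel_on S)"
  using anchored_decomposition_suffix[of "[]" coord_enum x]
  by (simp add: coord_enum anchored_term_eq)

text \<open>The dominating function separates the variables: an exponential in \<open>x\<close>,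
  integrable by assumption, times a Gaussian of rate \<open>\<beta> - M\<close> in \<open>y\<close>.
  Joint integrability licenses the exchange of the two integrals.\<close>

lemma integrable_anchored_kernel_pair:
  "integrable (target_measure \<Otimes>\<^sub>M lborel_on S) (\<lambda>(x, y). anchored_deriv S y * kernel_prod S x y)"
proof -
  interpret L: sigma_finite_measure "lborel_on S"
    by (rule lborel_product.sigma_finite) simp
  interpret pair_sigma_finite target_measure "lborel_on S" ..
  have [measurable]: "(\<lambda>z. snd z i) \<in> borel_measurable (target_measure \<Otimes>\<^sub>M lborel_on S)" if "i \<in> S" for i
    using measurable_compose[OF measurable_snd measurable_component_singleton[OF that, of "\<lambda>_. lborel"]]
    by simp
  have [measurable]: "(\<lambda>z. fst z $ i) \<in> borel_measurable (target_measure \<Otimes>\<^sub>M lborel_on S)" for i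
    by (rule measurable_compose[OF measurable_fst]) simp
  let ?D = "\<lambda>z. (C * exp (\<beta> * (norm (fst z))\<^sup>2)) * exp (- (\<beta> - M) * (\<Sum>i\<in>S. (snd z i)\<^sup>2))"
  show ?thesis
  proof (rule Bochner_Integration.integrable_bound)
    show "integrable (target_measure \<Otimes>\<^sub>M lborel_on S) ?D"
      using M_less integrable_exp
      by (intro integrable_pair_mult integrable_gaussian_lborel_on) simp_all
    show "(\<lambda>(x, y). anchored_deriv S y * kernel_prod S x y) \<in> borel_measurable (target_measure \<Otimes>\<^sub>M lborel_on S)"
      unfolding case_prod_beta by measurable
    have "\<bar>anchored_deriv S y * kernel_prod S x y\<bar> \<le> ?D (x, y)" for x y
    proof -
      have "\<bar>anchored_deriv S y * kernel_prod S x y\<bar> \<le> (C * exp (M * (\<Sum>i\<in>S. (y i)\<^sup>2)))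
        * (exp (\<beta> * (norm x)\<^sup>2) * exp (- \<beta> * (\<Sum>i\<in>S. (y i)\<^sup>2)))"
        unfolding abs_mult using C_nonneg
        by (intro mult_mono abs_anchored_deriv_le abs_kernel_prod_le) simp_all
      also have "\<dots> = ?D (x, y)" by (simp add: mult_exp_exp algebra_simps)
      finally show ?thesis .
    qed
    then show "AE z in target_measure \<Otimes>\<^sub>M lborel_on S.
      norm (case z of (x, y) \<Rightarrow> anchored_deriv S y * kernel_prod S x y) \<le> norm (?D z)"
      using C_nonneg by (intro AE_I2) (auto simp: abs_mult)
  qed
qed

lemma integrable_anchored_mean:
    "integrable (lborel_on S) (\<lambda>y. anchored_deriv S y * (\<integral>x. kernel_prod S x y \<partial>target_measure))"
  and integral_target_anchored:
    "(\<integral>x. (\<integral>y. anchored_deriv S y * kernel_prod S x y \<partial>lborel_on S) \<partial>target_measure)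
      = (\<integral>y. anchored_deriv S y * (\<integral>x. kernel_prod S x y \<partial>target_measure) \<partial>lborel_on S)"
  and integrable_target_anchored:
    "integrable target_measure (\<lambda>x. \<integral>y. anchored_deriv S y * kernel_prod S x y \<partial>lborel_on S)"
proof -
  interpret L: sigma_finite_measure "lborel_on S"
    by (rule lborel_product.sigma_finite) simp
  interpret pair_sigma_finite target_measure "lborel_on S" ..
  note int = integrable_anchored_kernel_pair[of S]
  show "integrable (lborel_on S) (\<lambda>y. anchored_deriv S y * (\<integral>x. kernel_prod S x y \<partial>target_measure))"
    using integrable_snd[OF int] by simp
  show "(\<integral>x. (\<integral>y. anchored_deriv S y * kernel_prod S x y \<partial>lborel_on S) \<partial>target_measure)
      = (\<integral>y. anchored_deriv S y * (\<integral>x. kernel_prod S x y \<partial>target_measure) \<partial>lborel_on S)"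
    using Fubini_integral[OF int] by simp
  show "integrable target_measure (\<lambda>x. \<integral>y. anchored_deriv S y * kernel_prod S x y \<partial>lborel_on S)"
    using integrable_fst[OF int] by simp
qed

lemma integrable_anchored_discrepancy:
    "integrable (lborel_on S) (\<lambda>y. anchored_deriv S y * kernel_discrepancy N X S y)" (is ?int)
  and integral_anchored_discrepancy:
    "(\<integral>y. anchored_deriv S y * kernel_discrepancy N X S y \<partial>lborel_on S)
      = (1 / real N) * (\<Sum>k=1..N. \<integral>y. anchored_deriv S y * kernel_prod S (X k) y \<partial>lborel_on S)
        - (\<integral>x. (\<integral>y. anchored_deriv S y * kernel_prod S x y \<partial>lborel_on S) \<partial>target_measure)" (is ?eq)
proof -
  have split: "anchored_deriv S y * kernel_discrepancy N X S y
    = (1 / real N) * (\<Sum>k=1..N. anchored_deriv S y * kernel_prod S (X k) y)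
      - anchored_deriv S y * (\<integral>x. kernel_prod S x y \<partial>target_measure)" for y
    by (simp add: kernel_discrepancy_def right_diff_distrib sum_distrib_left mult_ac)
  have sum: "integrable (lborel_on S) (\<lambda>y. (1 / real N) * (\<Sum>k=1..N. anchored_deriv S y * kernel_prod S (X k) y))"
    using integrable_anchored_kernel by (intro integrable_mult_right Bochner_Integration.integrable_sum) simp
  show ?int unfolding split using sum integrable_anchored_mean by (rule Bochner_Integration.integrable_diff)
  show ?eq
    unfolding split Bochner_Integration.integral_diff[OF sum integrable_anchored_mean] integral_target_anchored
    using integrable_anchored_kernel
    by (subst integral_mult_right_zero, subst Bochner_Integration.integral_sum) simp_all
qed

text \<open>An identity of Hlawka-Zaremba type: both means are linear, so on the anchored expansion
  their difference passes the derivatives by and acts on the kernels alone.\<close>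

lemma error_anchored_decomposition:
  "(1 / real N) * (\<Sum>k=1..N. g (X k)) - (\<integral>x. g x \<partial>target_measure)
    = (\<Sum>S\<in>UNIV. \<integral>y. anchored_deriv S y * kernel_discrepancy N X S y \<partial>lborel_on S)"
proof -
  let ?J = "\<lambda>S x. \<integral>y. anchored_deriv S y * kernel_prod S x y \<partial>lborel_on S"
  have "(\<integral>x. g x \<partial>target_measure) = (\<integral>x. (\<Sum>S\<in>UNIV. ?J S x) \<partial>target_measure)"
    by (rule arg_cong[where f="integral\<^sup>L target_measure"], rule ext, rule g_anchored_decomposition)
  also have "\<dots> = (\<Sum>S\<in>UNIV. \<integral>x. ?J S x \<partial>target_measure)"
    by (rule Bochner_Integration.integral_sum) (rule integrable_target_anchored)
  finally have mean: "(\<integral>x. g x \<partial>target_measure) = (\<Sum>S\<in>UNIV. \<integral>x. ?J S x \<partial>target_measure)" .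
  have "(\<Sum>k=1..N. g (X k)) = (\<Sum>k=1..N. \<Sum>S\<in>UNIV. ?J S (X k))"
    by (rule sum.cong[OF refl]) (rule g_anchored_decomposition)
  also have "\<dots> = (\<Sum>S\<in>UNIV. \<Sum>k=1..N. ?J S (X k))" by (rule sum.swap)
  finally show ?thesis
    unfolding integral_anchored_discrepancy mean
    by (simp add: sum_distrib_left sum_subtractf)
qed

section \<open>Interpolated bound on the error\<close>

text \<open>The true mean is added so that one factor serves both halves of a discrepancy; it also
  keeps this factor at least 1, which later permits raising its exponent.\<close>

definition exp_mean :: "nat \<Rightarrow> (nat \<Rightarrow> real ^ 'n) \<Rightarrow> real" where
  "exp_mean N X = (1 / real N) * (\<Sum>k=1..N. exp (\<beta> * (norm (X k))\<^sup>2))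
    + (\<integral>x. exp (\<beta> * (norm x)\<^sup>2) \<partial>target_measure)"

lemma target_exp_ge_1: "1 \<le> (\<integral>x. exp (\<beta> * (norm x)\<^sup>2) \<partial>target_measure)"
proof -
  have "(\<integral>x. 1 \<partial>target_measure) \<le> (\<integral>x. exp (\<beta> * (norm x)\<^sup>2) \<partial>target_measure)"
    using integrable_exp \<beta>_nonneg by (intro integral_mono) simp_all
  then show ?thesis using target.prob_space by simp
qed

lemma exp_mean_ge_1: "1 \<le> exp_mean N X"
proof -
  have "0 \<le> (1 / real N) * (\<Sum>k=1..N. exp (\<beta> * (norm (X k))\<^sup>2))"
    by (intro mult_nonneg_nonneg sum_nonneg) simp_all
  then show ?thesis unfolding exp_mean_def using target_exp_ge_1 by linarith
qed

text \<open>
  Markov's inequality \<^emph>\<open>before\<close> taking expectations: the bound is uniform in \<open>y\<close> with a single random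
  factor, which is what makes the moment estimate work without Minkowski's inequality.
\<close>

lemma abs_kernel_discrepancy_le_exp_mean:
  "\<bar>kernel_discrepancy N X S y\<bar> \<le> exp (- \<beta> * (\<Sum>i\<in>S. (y i)\<^sup>2)) * exp_mean N X"
proof -
  let ?e = "exp (- \<beta> * (\<Sum>i\<in>S. (y i)\<^sup>2))"
  have "\<bar>(1 / real N) * (\<Sum>k=1..N. kernel_prod S (X k) y)\<bar>
    \<le> (1 / real N) * (\<Sum>k=1..N. exp (\<beta> * (norm (X k))\<^sup>2) * ?e)"
    unfolding abs_mult
    by (intro mult_mono order_trans[OF sum_abs] sum_mono abs_kernel_prod_le) (simp_all add: sum_nonneg)
  moreover have "\<bar>\<integral>x. kernel_prod S x y \<partial>target_measure\<bar>
    \<le> (\<integral>x. exp (\<beta> * (norm x)\<^sup>2) * ?e \<partial>target_measure)"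
    using Bochner_Integration.integral_norm_bound_integral[of target_measure "\<lambda>x. kernel_prod S x y"
        "\<lambda>x. exp (\<beta> * (norm x)\<^sup>2) * ?e"] abs_kernel_prod_le integrable_exp
    \<comment> \<open>A non-integrable integrand has Bochner integral 0, for which the bound is
      trivial.\<close>
    by (cases "integrable target_measure (\<lambda>x. kernel_prod S x y)")
      (simp_all add: not_integrable_integral_eq)
  ultimately have "\<bar>kernel_discrepancy N X S y\<bar>
    \<le> (1 / real N) * (\<Sum>k=1..N. exp (\<beta> * (norm (X k))\<^sup>2) * ?e)
      + (\<integral>x. exp (\<beta> * (norm x)\<^sup>2) * ?e \<partial>target_measure)"
    unfolding kernel_discrepancy_def by linarith
  also have "\<dots> = ?e * exp_mean N X"
    by (simp add: exp_mean_def distrib_left sum_distrib_right[symmetric] mult_ac)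
  finally show ?thesis .
qed

text \<open>What interpolation leaves of the integrals in \<open>y\<close>: convergent Gaussian
  integrals when \<open>M < \<theta> * \<beta>\<close>.\<close>

definition error_constant :: "real \<Rightarrow> real" where
  "error_constant \<theta> = (\<Sum>S\<in>UNIV. \<integral>y. C * exp (- (\<theta> * \<beta> - M) * (\<Sum>i\<in>S. (y i)\<^sup>2)) \<partial>lborel_on (S :: 'n set))"

lemma error_constant_nonneg: "0 \<le> error_constant \<theta>"
  unfolding error_constant_def using C_nonneg by (intro sum_nonneg Bochner_Integration.integral_nonneg) simp

text \<open>\<theta> trades the uniform bound \<open>D\<close> for Gaussian decay in
  \<open>y\<close>. Decay at rate \<open>\<theta> * \<beta>\<close> beyond \<open>M\<close> is what
  offsets the growth of the derivatives; the remaining power \<open>1 - \<theta>\<close> of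
  \<open>D\<close> carries the convergence.\<close>

lemma abs_error_le:
  assumes \<theta>: "0 \<le> \<theta>" "\<theta> \<le> 1" "M < \<theta> * \<beta>" and D: "\<And>S y. \<bar>kernel_discrepancy N X S y\<bar> \<le> D"
  shows "\<bar>(1 / real N) * (\<Sum>k=1..N. g (X k)) - (\<integral>x. g x \<partial>target_measure)\<bar>
    \<le> error_constant \<theta> * (D powr (1 - \<theta>) * exp_mean N X powr \<theta>)"
proof -
  let ?b = "D powr (1 - \<theta>) * exp_mean N X powr \<theta>"
  let ?G = "\<lambda>(S :: 'n set) y. C * exp (- (\<theta> * \<beta> - M) * (\<Sum>i\<in>S. (y i)\<^sup>2))"
  have W: "0 \<le> exp_mean N X" using exp_mean_ge_1[of N X] by simp
  have pt: "\<bar>anchored_deriv S y * kernel_discrepancy N X S y\<bar> \<le> ?G S y * ?b" for S y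
  proof -
    let ?d = "kernel_discrepancy N X S y" and ?s = "\<Sum>i\<in>S. (y i)\<^sup>2"
    txt \<open>Interpolate between the two bounds on the discrepancy.\<close>
    have "\<bar>?d\<bar> = \<bar>?d\<bar> powr (1 - \<theta>) * \<bar>?d\<bar> powr \<theta>"
      by (simp add: powr_add[symmetric])
    also have "\<dots> \<le> D powr (1 - \<theta>) * (exp (- \<beta> * ?s) * exp_mean N X) powr \<theta>"
      using \<theta> D abs_kernel_discrepancy_le_exp_mean
      by (intro mult_mono powr_mono2) simp_all
    also have "\<dots> = exp (- \<theta> * \<beta> * ?s) * ?b"
      using W by (simp add: powr_mult exp_powr_real mult_ac)
    finally have "\<bar>anchored_deriv S y\<bar> * \<bar>?d\<bar> \<le> (C * exp (M * ?s)) * (exp (- \<theta> * \<beta> * ?s) * ?b)"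
      using C_nonneg by (intro mult_mono abs_anchored_deriv_le) simp_all
    also have "\<dots> = ?G S y * ?b" by (simp add: mult_exp_exp algebra_simps)
    finally show ?thesis by (simp add: abs_mult)
  qed
  have "\<bar>(1 / real N) * (\<Sum>k=1..N. g (X k)) - (\<integral>x. g x \<partial>target_measure)\<bar>
    \<le> (\<Sum>S\<in>UNIV. \<bar>\<integral>y. anchored_deriv S y * kernel_discrepancy N X S y \<partial>lborel_on S\<bar>)"
    unfolding error_anchored_decomposition by (rule sum_abs)
  also have "\<dots> \<le> (\<Sum>S\<in>UNIV. \<integral>y. ?G S y * ?b \<partial>lborel_on S)"
  proof (rule sum_mono)
    fix S :: "'n set"
    have "integrable (lborel_on S) (\<lambda>y. ?G S y * ?b)"
      using \<theta> by (intro integrable_mult_left integrable_mult_right integrable_gaussian_lborel_on) simp_all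
    then have "(\<integral>y. \<bar>anchored_deriv S y * kernel_discrepancy N X S y\<bar> \<partial>lborel_on S) \<le> (\<integral>y. ?G S y * ?b \<partial>lborel_on S)"
      using integrable_anchored_discrepancy pt by (intro Bochner_Integration.integral_mono integrable_abs)
    with integral_abs_bound
    show "\<bar>\<integral>y. anchored_deriv S y * kernel_discrepancy N X S y \<partial>lborel_on S\<bar> \<le> (\<integral>y. ?G S y * ?b \<partial>lborel_on S)"
      by (rule order_trans)
  qed
  also have "\<dots> = error_constant \<theta> * ?b"
    unfolding error_constant_def sum_distrib_right integral_mult_left_zero ..
  finally show ?thesis .
qed

end

section \<open>Moments of the error\<close>

context rqmc_error
begin

lemma target_integral_eq: "target_integral g (product_density q) = (\<integral>x. g x \<partial>target_measure)"
  and integrable_lborel_g: "integrable lborel (\<lambda>x. g x * product_density q x)"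
proof -
  have nn: "AE x in lborel. 0 \<le> product_density q x"
    using q by (intro AE_I2) (auto simp: product_density_def positive_continuous_density_def less_imp_le intro!: prod_nonneg)
  note [measurable] = borel_measurable_product_density
  show "target_integral g (product_density q) = (\<integral>x. g x \<partial>target_measure)"
    unfolding target_integral_def by (subst integral_density[OF _ _ nn]) (simp_all add: mult.commute)
  show "integrable lborel (\<lambda>x. g x * product_density q x)"
    using integrable_target_g by (subst (asm) integrable_density[OF _ _ nn]) (simp_all add: mult.commute)
qed

text \<open>Since \<open>\<theta> * p \<le> 1\<close> and \<open>exp_mean\<close> is at least 1, its
  power \<open>\<theta> * p\<close> is at most itself. The moment of order \<open>p\<close> of the
  error thus reduces to the first moment of \<open>exp_mean\<close>, which the marginal laws of the
  points determine.\<close>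

lemma error_moment_bound:
  fixes U :: "nat \<Rightarrow> 'w \<Rightarrow> real ^ 'n"
  assumes p: "1 \<le> p" and \<theta>: "0 \<le> \<theta>" "\<theta> * p \<le> 1" "M < \<theta> * \<beta>"
    and P: "prob_space P" and N: "0 < N"
    and U: "\<And>i. i \<in> {1..N} \<Longrightarrow> U i \<in> borel_measurable P"
    and box: "\<And>i w. i \<in> {1..N} \<Longrightarrow> w \<in> space P \<Longrightarrow> U i w \<in> box 0 1"
    and distr: "\<And>i. i \<in> {1..N} \<Longrightarrow> distr P borel (U i) = uniform_measure lborel (box 0 1)"
    and disc: "AE w in P. star_discrepancy N (\<lambda>i. U i w) \<le> D"
  defines "E \<equiv> \<lambda>w. \<bar>rqmc_estimate g (inverse_cdf_map q) N (\<lambda>i. U i w) - target_integral g (product_density q)\<bar> powr p"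
  shows "integrable P E"
    and "(\<integral>w. E w \<partial>P) powr (1 / p) \<le> error_constant \<theta> *
      (2 * (\<integral>x. exp (\<beta> * (norm x)\<^sup>2) \<partial>target_measure)) powr (1 / p) * (2 ^ CARD('n) * D) powr (1 - \<theta>)"
proof -
  interpret prob_space P by fact
  let ?X = "\<lambda>i w. inverse_cdf_map q (U i w)"
  let ?W = "\<lambda>w. exp_mean N (\<lambda>i. ?X i w)"
  let ?m = "\<integral>x. exp (\<beta> * (norm x)\<^sup>2) \<partial>target_measure"
  let ?c = "error_constant \<theta> * (2 ^ CARD('n) * D) powr (1 - \<theta>)"
  have X[measurable]: "?X i \<in> borel_measurable P" if "i \<in> {1..N}" for i
    using U[OF that] box[OF that] by (rule measurable_inverse_cdf_map)
  have law: "distr P borel (?X i) = target_measure" if "i \<in> {1..N}" for i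
    using P U[OF that] box[OF that] distr[OF that] by (rule distr_inverse_cdf_map)
  have c: "0 \<le> ?c" using error_constant_nonneg by simp
  have m: "0 \<le> ?m" using target_exp_ge_1 by simp
  have \<theta>1: "\<theta> \<le> 1" using mult_left_mono[OF p \<theta>(1)] \<theta>(2) by simp
  have int_exp: "integrable P (\<lambda>w. exp (\<beta> * (norm (?X i w))\<^sup>2))"
    and mean_exp: "(\<integral>w. exp (\<beta> * (norm (?X i w))\<^sup>2) \<partial>P) = ?m" if "i \<in> {1..N}" for i
    using integrable_exp integrable_distr_eq[OF X[OF that], of "\<lambda>x. exp (\<beta> * (norm x)\<^sup>2)"]
      integral_distr[OF X[OF that], of "\<lambda>x. exp (\<beta> * (norm x)\<^sup>2)"]
    by (simp_all add: law[OF that])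
  have int_W: "integrable P ?W"
    unfolding exp_mean_def
    by (intro Bochner_Integration.integrable_add integrable_mult_right Bochner_Integration.integrable_sum
        int_exp) simp_all
  \<comment> \<open>Every transported point has the target law, so the empirical half has the same
    mean \<open>?m\<close> as the constant half.\<close>
  have mean_W: "(\<integral>w. ?W w \<partial>P) = 2 * ?m"
  proof -
    have "(\<integral>w. (1 / real N) * (\<Sum>k=1..N. exp (\<beta> * (norm (?X k w))\<^sup>2)) \<partial>P)
      = (1 / real N) * (\<Sum>k=1..N. ?m)"
      unfolding integral_mult_right_zero
      by (subst Bochner_Integration.integral_sum) (use int_exp mean_exp in auto)
    moreover have "integrable P (\<lambda>w. (1 / real N) * (\<Sum>k=1..N. exp (\<beta> * (norm (?X k w))\<^sup>2)))"
      by (intro integrable_mult_right Bochner_Integration.integrable_sum int_exp) simp_all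
    ultimately show ?thesis
      unfolding exp_mean_def using N by (subst Bochner_Integration.integral_add) (simp_all add: prob_space)
  qed
  have bound: "AE w in P. E w \<le> ?c powr p * ?W w"
    using disc AE_space
  proof eventually_elim
    case (elim w)
    have K: "\<bar>kernel_discrepancy N (\<lambda>i. ?X i w) S y\<bar> \<le> 2 ^ CARD('n) * D" for S y
    proof -
      have "\<bar>kernel_discrepancy N (\<lambda>i. ?X i w) S y\<bar> \<le> 2 ^ CARD('n) * star_discrepancy N (\<lambda>i. U i w)"
        using elim(2) box by (intro abs_kernel_discrepancy_le_star_discrepancy) auto
      also have "\<dots> \<le> 2 ^ CARD('n) * D" using elim(1) by (intro mult_left_mono) simp_all
      finally show ?thesis .
    qed
    have W: "1 \<le> ?W w" by (rule exp_mean_ge_1)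
    have "\<bar>rqmc_estimate g (inverse_cdf_map q) N (\<lambda>i. U i w) - target_integral g (product_density q)\<bar>
      \<le> ?c * ?W w powr \<theta>"
      using abs_error_le[OF \<theta>(1) \<theta>1 \<theta>(3) K]
      unfolding rqmc_estimate_def target_integral_eq by (simp add: mult_ac)
    then have "E w \<le> (?c * ?W w powr \<theta>) powr p"
      unfolding E_def using p by (intro powr_mono2) simp_all
    also have "\<dots> = ?c powr p * ?W w powr (\<theta> * p)"
      using c by (simp add: powr_mult powr_powr)
    also have "\<dots> \<le> ?c powr p * ?W w powr 1"
      using W \<theta>(2) by (intro mult_left_mono powr_mono) simp_all
    finally show ?case using W by simp
  qed
  have [measurable]: "E \<in> borel_measurable P"
    unfolding E_def rqmc_estimate_def by measurable
  show int: "integrable P E"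
  proof (rule Bochner_Integration.integrable_bound)
    show "integrable P (\<lambda>w. ?c powr p * ?W w)" using int_W by simp
    show "AE w in P. norm (E w) \<le> norm (?c powr p * ?W w)"
      using bound by eventually_elim (simp add: E_def)
  qed measurable
  have "(\<integral>w. E w \<partial>P) \<le> (\<integral>w. ?c powr p * ?W w \<partial>P)"
    using int int_W bound by (intro integral_mono_AE) simp_all
  also have "\<dots> = ?c powr p * (2 * ?m)" using mean_W by simp
  finally have "(\<integral>w. E w \<partial>P) powr (1 / p) \<le> (?c powr p * (2 * ?m)) powr (1 / p)"
    using p by (intro powr_mono2 Bochner_Integration.integral_nonneg) (simp_all add: E_def)
  also have "\<dots> = ?c * (2 * ?m) powr (1 / p)"
    using p c m error_constant_nonneg[of \<theta>] by (simp add: powr_mult powr_powr)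
  finally show "(\<integral>w. E w \<partial>P) powr (1 / p)
      \<le> error_constant \<theta> * (2 * ?m) powr (1 / p) * (2 ^ CARD('n) * D) powr (1 - \<theta>)"
    by (simp add: mult_ac)
qed

lemma Lp_error_bound:
  fixes A :: "nat set" and P :: "nat \<Rightarrow> 'w measure" and u :: "nat \<Rightarrow> nat \<Rightarrow> 'w \<Rightarrow> real ^ 'n"
  assumes p: "1 \<le> p" and \<theta>: "0 \<le> \<theta>" "\<theta> * p \<le> 1" "M < \<theta> * \<beta>" and rqmc: "rqmc_points A P u"
  shows "error_well_defined p g q A P u"
    and "\<exists>K. \<forall>N\<in>A. Lp_error p g q P u N \<le> K * (ln (real N) ^ (CARD('n) - 1) / real N) powr (1 - \<theta>)"
proof -
  from rqmc obtain B where B: "0 < B"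
    "\<And>N. N \<in> A \<Longrightarrow> AE w in P N. star_discrepancy N (\<lambda>i. u N i w) \<le> B * (ln (real N) ^ (CARD('n) - 1) / real N)"
    unfolding rqmc_points_def by blast
  let ?m = "\<integral>x. exp (\<beta> * (norm x)\<^sup>2) \<partial>target_measure"
  let ?L = "\<lambda>N. ln (real N) ^ (CARD('n) - 1) / real N"
  let ?K = "error_constant \<theta> * (2 * ?m) powr (1 / p)"
  have E: "integrable (P N) (abs_error_pow p g q u N)"
    "Lp_error p g q P u N \<le> ?K * (2 ^ CARD('n) * (B * ?L N)) powr (1 - \<theta>)" if "N \<in> A" for N
    unfolding Lp_error_def abs_error_pow_def[abs_def]
    using rqmc that B(2)[OF that] p \<theta>
    by (intro error_moment_bound; force simp: rqmc_points_def)+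
  show "error_well_defined p g q A P u"
    unfolding error_well_defined_def using E(1) integrable_lborel_g by blast
  show "\<exists>K. \<forall>N\<in>A. Lp_error p g q P u N \<le> K * ?L N powr (1 - \<theta>)"
  proof (intro exI ballI)
    fix N assume N: "N \<in> A"
    then have "2 \<le> N" using rqmc by (simp add: rqmc_points_def)
    then have "0 \<le> ?L N" by simp
    then have "(2 ^ CARD('n) * B * ?L N) powr (1 - \<theta>) = (2 ^ CARD('n) * B) powr (1 - \<theta>) * ?L N powr (1 - \<theta>)"
      using B(1) by (intro powr_mult)
    then have "?K * (2 ^ CARD('n) * (B * ?L N)) powr (1 - \<theta>)
      = (?K * (2 ^ CARD('n) * B) powr (1 - \<theta>)) * ?L N powr (1 - \<theta>)"
      by (simp only: mult.assoc)
    with E(2)[OF N] show "Lp_error p g q P u N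
      \<le> (?K * (2 ^ CARD('n) * B) powr (1 - \<theta>)) * ?L N powr (1 - \<theta>)" by (simp only:)
  qed
qed

end

section \<open>Sub-Gaussian tails and exponential moments\<close>

text \<open>The polynomial factor of the tail and the constant behind the limsup are absorbed by
  lowering the exponent from \<alpha> to \<gamma>.\<close>

lemma SG_tail:
  fixes f :: "real ^ 'n::finite \<Rightarrow> real"
  assumes SG: "SG \<eta> \<alpha> f" and \<gamma>: "\<gamma> < \<alpha>"
  shows "eventually (\<lambda>t. measure (density lborel (\<lambda>x. ennreal (f x))) {x. norm x > t} \<le> exp (- \<gamma> * t\<^sup>2)) at_top"
proof -
  define m where "m t = measure (density lborel (\<lambda>x. ennreal (f x))) {x. norm x > t}" for t
  define k where "k = nat \<bar>\<eta>\<bar>"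
  have "\<exists>r::real. Limsup at_top (\<lambda>t. ereal (t powi (- \<eta>) * exp (\<alpha> * t\<^sup>2) * m t)) < ereal r"
    using ereal_dense2[OF SG[unfolded SG_def]] unfolding m_def by blast
  then obtain r where "Limsup at_top (\<lambda>t. ereal (t powi (- \<eta>) * exp (\<alpha> * t\<^sup>2) * m t)) < ereal r" ..
  from Limsup_lessD[OF this] have "eventually (\<lambda>t. t powi (- \<eta>) * exp (\<alpha> * t\<^sup>2) * m t < r) at_top"
    by simp
  moreover have "((\<lambda>t. \<bar>r\<bar> * (t ^ k / exp t)) \<longlongrightarrow> \<bar>r\<bar> * 0) at_top"
    by (intro tendsto_intros tendsto_power_div_exp_0)
  then have "eventually (\<lambda>t. \<bar>r\<bar> * (t ^ k / exp t) < 1) at_top"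
    by (auto dest: order_tendstoD(2)[where a=1])
  ultimately show ?thesis
    \<comment> \<open>From here on \<open>t \<ge> 1\<close>, so powers increase with their exponent,
      and \<open>t \<le> (\<alpha> - \<gamma>) * t\<^sup>2\<close>, so the margin pays for the
      \<open>exp t\<close> that absorbs the polynomial.\<close>
    using eventually_ge_at_top[of "max 1 (1 / (\<alpha> - \<gamma>))"] unfolding m_def[symmetric]
  proof eventually_elim
    case (elim t)
    have t: "1 \<le> t" "1 \<le> (\<alpha> - \<gamma>) * t" using elim(3) \<gamma> by (simp_all add: field_simps)
    have "m t = t powi \<eta> * exp (- \<alpha> * t\<^sup>2) * (t powi (- \<eta>) * exp (\<alpha> * t\<^sup>2) * m t)"
      using t by (simp add: power_int_minus exp_minus field_simps)
    also have "\<dots> \<le> t powi \<eta> * exp (- \<alpha> * t\<^sup>2) * \<bar>r\<bar>"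
      using elim(1) t by (intro mult_left_mono) auto
    also have "\<dots> \<le> t ^ k * exp (- \<alpha> * t\<^sup>2) * \<bar>r\<bar>"
    proof -
      have "t powi \<eta> \<le> t powi (int k)" using t unfolding k_def by (intro power_int_increasing) auto
      then show ?thesis by (intro mult_right_mono) simp_all
    qed
    also have "\<dots> = (\<bar>r\<bar> * (t ^ k / exp t)) * exp (t - \<alpha> * t\<^sup>2)"
      by (simp add: exp_diff exp_minus field_simps)
    also have "\<dots> \<le> 1 * exp (t - \<alpha> * t\<^sup>2)" using elim(2) by (intro mult_right_mono) simp_all
    also have "t - \<alpha> * t\<^sup>2 \<le> - \<gamma> * t\<^sup>2"
      using mult_right_mono[OF t(2), of t] t(1) by (simp add: power2_eq_square algebra_simps)
    finally show ?case by simp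
  qed
qed

text \<open>On the shell between radii \<open>n\<close> and \<open>n + 1\<close> the integrand is at
  most \<open>exp (\<beta> * (real n + 1)\<^sup>2)\<close>, while the tail beyond \<open>n\<close>
  is eventually at most \<open>exp (- \<gamma> * (real n)\<^sup>2)\<close> with \<gamma> above
  \<beta>; the products are summable.\<close>

lemma SG_integrable_exp:
  fixes f :: "real ^ 'n::finite \<Rightarrow> real"
  assumes P: "prob_space (density lborel (\<lambda>x. ennreal (f x)))" and SG: "SG \<eta> \<alpha> f"
    and \<beta>: "0 \<le> \<beta>" "\<beta> < \<alpha>"
  shows "integrable (density lborel (\<lambda>x. ennreal (f x))) (\<lambda>x. exp (\<beta> * (norm x)\<^sup>2))"
proof -
  let ?Q = "density lborel (\<lambda>x. ennreal (f x))"
  interpret prob_space ?Q by fact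
  define \<gamma> where "\<gamma> = (\<alpha> + \<beta>) / 2"
  have \<gamma>: "\<beta> < \<gamma>" "\<gamma> < \<alpha>" using \<beta> by (simp_all add: \<gamma>_def)
  let ?a = "\<lambda>n. exp (\<beta> * (real n + 1)\<^sup>2)"
  let ?S = "\<lambda>n. {x :: real ^ 'n. real n < norm x}"
  have "eventually (\<lambda>n. prob (?S n) \<le> exp (- \<gamma> * (real n)\<^sup>2)) sequentially"
    using SG_tail[OF SG \<gamma>(2)] filterlim_real_sequentially by (rule eventually_compose_filterlim)
  then have "eventually (\<lambda>n. norm (?a n * prob (?S n)) \<le> exp (-1) ^ n) sequentially"
    \<comment> \<open>The threshold gives
      \<open>3 * \<beta> + 1 \<le> (\<gamma> - \<beta>) * real n\<close>, which absorbs the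
      lower-order terms of \<open>\<beta> * (real n + 1)\<^sup>2\<close> and leaves the exponent
      \<open>- real n\<close>, hence a geometric majorant.\<close>
    using eventually_ge_at_top[of "max 1 (nat \<lceil>(3 * \<beta> + 1) / (\<gamma> - \<beta>)\<rceil>)"]
  proof eventually_elim
    case (elim n)
    have n1: "1 \<le> real n" using elim(2) by simp
    have "(3 * \<beta> + 1) / (\<gamma> - \<beta>) \<le> real n" using elim(2) by linarith
    then have "3 * \<beta> + 1 \<le> (\<gamma> - \<beta>) * real n" using \<gamma> by (simp add: field_simps)
    from mult_right_mono[OF this, of "real n"] have "(3 * \<beta> + 1) * real n \<le> (\<gamma> - \<beta>) * real n * real n" by simp
    moreover have "\<beta> * 1 \<le> \<beta> * real n" using \<beta> n1 by (intro mult_left_mono) simp_all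
    ultimately have e: "\<beta> * (real n + 1)\<^sup>2 - \<gamma> * (real n)\<^sup>2 \<le> - real n"
      by (simp add: power2_eq_square algebra_simps)
    have "?a n * prob (?S n) \<le> ?a n * exp (- \<gamma> * (real n)\<^sup>2)" using elim(1) by simp
    also have "\<dots> = exp (\<beta> * (real n + 1)\<^sup>2 - \<gamma> * (real n)\<^sup>2)" by (simp add: mult_exp_exp)
    also have "\<dots> \<le> exp (- real n)" using e by simp
    also have "\<dots> = exp (-1) ^ n" by (simp add: exp_of_nat_mult[symmetric])
    finally show ?case by simp
  qed
  then have summable: "summable (\<lambda>n. ?a n * prob (?S n))"
    by (rule summable_comparison_test_ev) (simp add: summable_geometric)
  \<comment> \<open>The summand 1 covers \<open>x = 0\<close>, which lies in no \<open>?S n\<close>;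
    for other \<open>x\<close> the one term with \<open>n\<close> just below the norm
    suffices.\<close>
  have pt: "ennreal (exp (\<beta> * (norm x)\<^sup>2)) \<le> 1 + (\<Sum>n. ennreal (?a n) * indicator (?S n) x)" for x :: "real ^ 'n"
  proof (cases "x = 0")
    case True
    then show ?thesis by simp
  next
    case False
    define n where "n = nat (\<lceil>norm x\<rceil> - 1)"
    have "0 < \<lceil>norm x\<rceil>" using False by simp
    then have n: "real n < norm x" "norm x \<le> real n + 1" unfolding n_def by linarith+
    define h where "h = (\<lambda>n. ennreal (?a n) * indicator (?S n) x)"
    have "\<beta> * (norm x)\<^sup>2 \<le> \<beta> * (real n + 1)\<^sup>2"
      using n(2) \<beta>(1) by (intro mult_left_mono power_mono) simp_all
    then have "ennreal (exp (\<beta> * (norm x)\<^sup>2)) \<le> h n"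
      using n(1) by (auto simp: h_def intro: ennreal_leI)
    also have "h n \<le> (\<Sum>n. h n)"
      using sum_le_suminf[OF summableI, of "{n}" h] by (auto simp del: sum_ennreal)
    also have "\<dots> = (\<Sum>n. ennreal (?a n) * indicator (?S n) x)" unfolding h_def ..
    also have "\<dots> \<le> 1 + \<dots>" by simp
    finally show ?thesis .
  qed
  have "(\<integral>\<^sup>+x. ennreal (exp (\<beta> * (norm x)\<^sup>2)) \<partial>?Q)
    \<le> (\<integral>\<^sup>+x. 1 + (\<Sum>n. ennreal (?a n) * indicator (?S n) x) \<partial>?Q)"
    by (intro nn_integral_mono pt)
  also have "\<dots> = 1 + (\<Sum>n. ennreal (?a n) * emeasure ?Q (?S n))"
    using emeasure_space_1
    by (subst nn_integral_add) (simp_all add: nn_integral_suminf nn_integral_cmult)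
  also have "\<dots> = 1 + (\<Sum>n. ennreal (?a n * prob (?S n)))"
    by (simp add: emeasure_eq_measure ennreal_mult)
  also have "(\<Sum>n. ennreal (?a n * prob (?S n))) = ennreal (\<Sum>n. ?a n * prob (?S n))"
    by (rule suminf_ennreal2[OF _ summable]) simp
  also have "1 + \<dots> < \<infinity>" unfolding infinity_ennreal_def ennreal_add_less_top by simp
  finally have fin: "(\<integral>\<^sup>+x. ennreal (exp (\<beta> * (norm x)\<^sup>2)) \<partial>?Q) < \<infinity>" .
  show ?thesis
  proof (rule integrableI_bounded)
    show "(\<lambda>x. exp (\<beta> * (norm x)\<^sup>2)) \<in> borel_measurable ?Q" by measurable
    show "(\<integral>\<^sup>+x. ennreal (norm (exp (\<beta> * (norm x)\<^sup>2))) \<partial>?Q) < \<infinity>" using fin by simp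
  qed
qed

section \<open>Rates\<close>

text \<open>Every power of the logarithm is eventually below \<open>real N powr \<epsilon>\<close>,
  and once the logarithm is at least 1, the exponent \<open>1 - \<theta>\<close> on it may be raised
  to 1.\<close>

lemma log_rate_bigo:
  fixes \<theta> \<epsilon> :: real
  assumes \<theta>: "0 \<le> \<theta>" "\<theta> \<le> 1" and r: "\<theta> - 1 + \<epsilon> \<le> r" and \<epsilon>: "0 < \<epsilon>"
  shows "(\<lambda>N::nat. (ln (real N) ^ m / real N) powr (1 - \<theta>)) \<in> O(\<lambda>N. real N powr r)"
proof -
  have "(\<lambda>x::real. ln x ^ m) \<in> o(\<lambda>x. x powr \<epsilon>)"
    using \<epsilon> by real_asymp
  then have "(\<lambda>N::nat. ln (real N) ^ m) \<in> o(\<lambda>N. real N powr \<epsilon>)"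
    using filterlim_real_sequentially by (rule landau_o.small.compose)
  from landau_o.smallD[OF this, of 1]
  have "eventually (\<lambda>N::nat. \<bar>ln (real N) ^ m\<bar> \<le> real N powr \<epsilon>) sequentially" by simp
  then have "eventually (\<lambda>N::nat. norm ((ln (real N) ^ m / real N) powr (1 - \<theta>)) \<le> 1 * norm (real N powr r)) sequentially"
    \<comment> \<open>From 3 on, \<open>N\<close> exceeds \<open>exp 1\<close> and its logarithm is
      at least 1.\<close>
    using eventually_ge_at_top[of 3]
  proof eventually_elim
    case (elim N)
    have "exp 1 \<le> real N" using elim(2) exp_le by simp
    then have "1 \<le> ln (real N)" using elim(2) by (simp add: ln_ge_iff)
    then have l: "1 \<le> ln (real N) ^ m" by simp
    have "(ln (real N) ^ m / real N) powr (1 - \<theta>) = (ln (real N) ^ m) powr (1 - \<theta>) * real N powr (\<theta> - 1)"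
      using l by (simp add: powr_divide powr_diff)
    also have "\<dots> \<le> (ln (real N) ^ m) powr 1 * real N powr (\<theta> - 1)"
      using l \<theta> by (intro mult_right_mono powr_mono) simp_all
    also have "\<dots> \<le> real N powr \<epsilon> * real N powr (\<theta> - 1)"
      using l elim(1) by (intro mult_right_mono) simp_all
    also have "\<dots> \<le> real N powr r"
      using r elim(2) by (simp add: powr_add[symmetric] powr_mono)
    finally show ?case by simp
  qed
  then show ?thesis by (rule bigoI)
qed

text \<open>The error is controlled at admissible sizes only, whereas the rates are compared along
  all integers; this moves the comparison to the restricted filter.\<close>

lemma bigo_restrict_set:
  fixes f h b :: "nat \<Rightarrow> real"
  assumes "\<And>N. N \<in> A \<Longrightarrow> 0 \<le> f N" "\<And>N. N \<in> A \<Longrightarrow> f N \<le> K * h N" "h \<in> O(b)"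
    and "\<And>N. 0 \<le> h N"
  shows "f \<in> O[inf at_top (principal A)](b)"
proof -
  have "f \<in> O[inf at_top (principal A)](h)"
  proof (rule bigoI[where c="\<bar>K\<bar>"])
    have "norm (f N) \<le> \<bar>K\<bar> * norm (h N)" if "N \<in> A" for N
    proof -
      have "K * h N \<le> \<bar>K\<bar> * h N" using assms(4) by (intro mult_right_mono) simp_all
      with assms(1,2)[OF that] assms(4) show ?thesis by simp
    qed
    then show "eventually (\<lambda>N. norm (f N) \<le> \<bar>K\<bar> * norm (h N)) (inf at_top (principal A))"
      by (simp add: eventually_inf_principal)
  qed
  also have "h \<in> O[inf at_top (principal A)](b)"
    using assms(3) by (rule landau_o.big.filter_mono'[OF inf_le1, THEN subsetD])
  finally show ?thesis .
qed

section \<open>The two regimes of the growth rate\<close>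

theorem theorem1:
  fixes g :: "real ^ 'n::finite \<Rightarrow> real"
    and q :: "'n \<Rightarrow> real \<Rightarrow> real"
    and p M :: real
    and A :: "nat set"
    and P :: "nat \<Rightarrow> 'w measure"
    and u :: "nat \<Rightarrow> nat \<Rightarrow> 'w \<Rightarrow> real ^ 'n"
  assumes "1 \<le> p"
    and "growth_condition M g"
    and "\<And>j. positive_continuous_density (q j)"
    and "rqmc_points A P u"
  shows "(M < 0 \<longrightarrow>
            error_well_defined p g q A P u \<and>
            Lp_error p g q P u
              \<in> O[inf at_top (principal A)](\<lambda>N. real N powr (- 1) * ln (real N) ^ (CARD('n) - 1)))
       \<and> (\<forall>(\<eta>::int) (\<alpha>::real). 0 < \<alpha> \<and> SG \<eta> \<alpha> (product_density q) \<and> 0 \<le> M \<and> M < \<alpha> / p \<longrightarrow>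
            error_well_defined p g q A P u \<and>
            (\<forall>\<epsilon>>0. Lp_error p g q P u
              \<in> O[inf at_top (principal A)](\<lambda>N. real N powr (- 1 + p * M / \<alpha> + \<epsilon>))))"
proof (intro conjI[of "M < 0 \<longrightarrow> _"] impI allI)
  note p = assms(1) and rqmc = assms(4)
  interpret positive_product_density q by unfold_locales (rule assms(3))
  interpret target: prob_space target_measure by (rule prob_space_target)
  obtain C where growth_function: "growth_function g M C"
    using assms(2) unfolding growth_condition_def growth_function_def by blast
  have nonneg: "0 \<le> Lp_error p g q P u N" for N by (simp add: Lp_error_def)
  let ?L = "\<lambda>N. ln (real N) ^ (CARD('n) - 1) / real N"
  {
    assume M: "M < 0"
    \<comment> \<open>With exponent 0 the exponential moment is the total mass. The choice of 0 for
      \<theta> below then keeps the full power of the discrepancy, the decay of the derivatives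
      making the Gaussian integrals converge.\<close>
    interpret rqmc_error q g M C 0
      using growth_function M
      by (intro rqmc_error.intro positive_product_density_axioms rqmc_error_axioms.intro) simp_all
    have "error_well_defined p g q A P u"
      using Lp_error_bound(1)[OF p _ _ _ rqmc, of 0] M by simp
    moreover obtain K where K: "\<And>N. N \<in> A \<Longrightarrow> Lp_error p g q P u N \<le> K * ?L N powr (1 - 0)"
      using Lp_error_bound(2)[OF p _ _ _ rqmc, of 0] M by auto
    moreover have big: "(\<lambda>N. ?L N powr (1 - 0)) \<in> O(\<lambda>N. real N powr (- 1) * ln (real N) ^ (CARD('n) - 1))"
    proof (rule bigoI[where c=1], intro eventually_mono[OF eventually_ge_at_top[of 1]])
      fix N :: nat assume "1 \<le> N"
      then have "0 \<le> ?L N" by simp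
      then show "norm (?L N powr (1 - 0)) \<le> 1 * norm (real N powr (- 1) * ln (real N) ^ (CARD('n) - 1))"
        using \<open>1 \<le> N\<close> by (simp add: powr_minus divide_inverse mult.commute)
    qed
    ultimately show "error_well_defined p g q A P u \<and> Lp_error p g q P u
        \<in> O[inf at_top (principal A)](\<lambda>N. real N powr (- 1) * ln (real N) ^ (CARD('n) - 1))"
      by (intro conjI bigo_restrict_set[OF nonneg K big]) (assumption | rule powr_ge_zero)+
  }
  {
    fix \<eta> :: int and \<alpha> :: real
    assume "0 < \<alpha> \<and> SG \<eta> \<alpha> (product_density q) \<and> 0 \<le> M \<and> M < \<alpha> / p"
    then have \<alpha>: "0 < \<alpha>" and SG: "SG \<eta> \<alpha> (product_density q)" and M: "0 \<le> M" "M < \<alpha> / p" by auto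
    have rate: "error_well_defined p g q A P u \<and>
        Lp_error p g q P u \<in> O[inf at_top (principal A)](\<lambda>N. real N powr (- 1 + p * M / \<alpha> + \<epsilon>))"
      if \<epsilon>: "0 < \<epsilon>" for \<epsilon>
    proof -
      txt \<open>The moment bound holds for every exponent \<open>\<theta>\<close> with \<open>M / \<alpha> < \<theta> \<le> 1 / p\<close>, which gives the rate
        \<open>- 1 + M / \<alpha> + \<epsilon>\<close>; this is at least as good as the claimed one since \<open>p \<ge> 1\<close>.\<close>
      define \<theta> where "\<theta> = min (1 / p) (M / \<alpha> + \<epsilon> / 2)"
      have "M / \<alpha> < \<theta>" using M(2) \<alpha> p \<epsilon> by (simp add: \<theta>_def field_simps)
      moreover have "0 \<le> M / \<alpha>" using M(1) \<alpha> by simp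
      ultimately have \<theta>0: "0 < \<theta>" by linarith
      have \<theta>p: "\<theta> * p \<le> 1"
      proof -
        have "\<theta> * p \<le> (1 / p) * p" unfolding \<theta>_def using p by (intro mult_right_mono) simp_all
        then show ?thesis using p by simp
      qed
      have \<theta>1: "\<theta> \<le> 1" using mult_left_mono[OF p less_imp_le[OF \<theta>0]] \<theta>p by simp
      have "M / \<theta> < \<alpha>" using \<open>M / \<alpha> < \<theta>\<close> \<theta>0 \<alpha> by (simp add: field_simps)
      \<comment> \<open>The lower bound makes the Gaussian integrals converge, the upper one makes
        the exponential moment finite.\<close>
      then obtain \<beta> where \<beta>: "M / \<theta> < \<beta>" and \<beta>\<alpha>: "\<beta> < \<alpha>" using dense by blast
      have \<beta>0: "0 \<le> \<beta>" using \<beta> M(1) \<theta>0 by (smt (verit) divide_nonneg_pos)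
      have M\<theta>: "M < \<theta> * \<beta>" using \<beta> \<theta>0 by (simp add: field_simps)
      have M\<beta>: "M < \<beta>" using M\<theta> mult_right_mono[OF \<theta>1 \<beta>0] by simp
      interpret rqmc_error q g M C \<beta>
        using growth_function \<beta>0 M\<beta> SG_integrable_exp[OF prob_space_target SG \<beta>0 \<beta>\<alpha>]
        by (intro rqmc_error.intro positive_product_density_axioms rqmc_error_axioms.intro)
      have "error_well_defined p g q A P u"
        using Lp_error_bound(1)[OF p _ \<theta>p M\<theta> rqmc] \<theta>0 by simp
      moreover obtain K where K: "\<And>N. N \<in> A \<Longrightarrow> Lp_error p g q P u N \<le> K * ?L N powr (1 - \<theta>)"
        using Lp_error_bound(2)[OF p _ \<theta>p M\<theta> rqmc] \<theta>0 by auto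
      moreover have big: "(\<lambda>N. ?L N powr (1 - \<theta>)) \<in> O(\<lambda>N. real N powr (- 1 + p * M / \<alpha> + \<epsilon>))"
      \<comment> \<open>One half of \<epsilon> is spent in \<theta>, the other absorbs the
        logarithms.\<close>
      proof (rule log_rate_bigo[where \<epsilon>="\<epsilon> / 2"])
        have "M / \<alpha> \<le> p * (M / \<alpha>)" using mult_right_mono[OF p \<open>0 \<le> M / \<alpha>\<close>] by simp
        then show "\<theta> - 1 + \<epsilon> / 2 \<le> - 1 + p * M / \<alpha> + \<epsilon>" unfolding \<theta>_def by simp
      qed (use \<theta>0 \<theta>1 \<epsilon> in simp_all)
      ultimately show ?thesis
        by (intro conjI bigo_restrict_set[OF nonneg K big]) (assumption | rule powr_ge_zero)+
    qed
    show "error_well_defined p g q A P u \<and> (\<forall>\<epsilon>>0. Lp_error p g q P u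
        \<in> O[inf at_top (principal A)](\<lambda>N. real N powr (- 1 + p * M / \<alpha> + \<epsilon>)))"
      \<comment> \<open>The instance at 1 extracts well-definedness, which does not depend on
        \<epsilon>.\<close>
      using rate rate[of 1] by simp
  }
qed

end
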